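(* The endofunctors $\wp$ and $\overline{\wp}$ of the category of $\mathbb{S}$-collections are lax monoidal with respect to the monoidal category $(\mathbb{S}\text{-}\mathsf{Coll},\circ,\mathsf{I})$, where $\circ$ is the composition product.
   Context: An $\mathbb{S}$-collection is a family $\mathcal{O}=\{\mathcal{O}(n)\}_{n\in\mathbb{N}}$ of sets, each $\mathcal{O}(n)$ equipped with a right action of the symmetric group $\mathbb{S}_n$; morphisms are arity-wise equivariant maps, and $\mathbb{S}\text{-}\mathsf{Coll}$ is the resulting category. The composition product is the usual composite product of symmetric sequences in sets, whose monoids are the set-theoretic symmetric operads: $(\mathcal{O}\circ\mathcal{Q})(n)=\bigsqcup_{k\ge 0}\mathcal{O}(k)\times_{\mathbb{S}_k}\bigsqcup_{n_1+\cdots+n_k=n}\mathrm{Ind}_{\mathbb{S}_{n_1}\times\cdots\times\mathbb{S}_{n_k}}^{\mathbb{S}_n}\bigl(\mathcal{Q}(n_1)\times\cdots\times\mathcal{Q}(n_k)\bigr)$, with unit $\mathsf{I}$ given by $\mathsf{I}(1)=\{*\}$ and $\mathsf{I}(n)=\emptyset$ for $n\neq 1$. For a set $S$, $\wp(S)$ is the set of all subsets of $S$ and $\overline{\wp}(S)=\wp(S)\setminus\{\emptyset\}$; both are functors on sets via direct image. On $\mathbb{S}$-collections they are applied arity-wise: $(\wp\mathcal{O})(n)=\wp(\mathcal{O}(n))$ and $(\overline{\wp}\mathcal{O})(n)=\overline{\wp}(\mathcal{O}(n))$ with the induced $\mathbb{S}_n$-actions. A lax monoidal endofunctor $F$ is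 one equipped with a natural transformation $\varphi_{X,Y}\colon F(X)\circ F(Y)\to F(X\circ Y)$ and a map $\varphi_0\colon \mathsf{I}\to F(\mathsf{I})$ satisfying the usual associativity and unit coherence axioms. *)

theory Defs
  imports "HOL-Combinatorics.Combinatorics"
begin

text \<open>The symmetric group on \<open>n\<close> letters acts on the letters \<open>0, \<dots>, n - 1\<close>; its product is \<open>\<circ>\<close>.\<close>

definition Sym :: "nat \<Rightarrow> (nat \<Rightarrow> nat) set" where
  "Sym n = {\<sigma>. \<sigma> permutes {..<n}}"

record 'a scoll =
  ops :: "nat \<Rightarrow> 'a set"
  act :: "nat \<Rightarrow> 'a \<Rightarrow> (nat \<Rightarrow> nat) \<Rightarrow> 'a"

definition s_collection :: "'a scoll \<Rightarrow> bool" where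
  "s_collection X \<longleftrightarrow>
    (\<forall>n. \<forall>x\<in>ops X n.
       (\<forall>\<sigma>\<in>Sym n. act X n x \<sigma> \<in> ops X n) \<and>
       act X n x id = x \<and>
       (\<forall>\<sigma>\<in>Sym n. \<forall>\<tau>\<in>Sym n. act X n x (\<sigma> \<circ> \<tau>) = act X n (act X n x \<sigma>) \<tau>))"

text \<open>A morphism is an arity-indexed family of functions of which only the values on the
  operations of the source matter; accordingly parallel morphisms are compared by \<open>mor_eq\<close>.\<close>

type_synonym ('a, 'b) mor = "nat \<Rightarrow> 'a \<Rightarrow> 'b"

definition morphism :: "'a scoll \<Rightarrow> 'b scoll \<Rightarrow> ('a, 'b) mor \<Rightarrow> bool" where
  "morphism X Y f \<longleftrightarrow>
    (\<forall>n. \<forall>x\<in>ops X n. f n x \<in> ops Y n \<and> (\<forall>\<sigma>\<in>Sym n. f n (act X n x \<sigma>) = act Y n (f n x) \<sigma>))"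

definition mor_eq :: "'a scoll \<Rightarrow> ('a, 'b) mor \<Rightarrow> ('a, 'b) mor \<Rightarrow> bool" where
  "mor_eq X f g \<longleftrightarrow> (\<forall>n. \<forall>x\<in>ops X n. f n x = g n x)"

definition mor_id :: "('a, 'a) mor" where
  "mor_id n x = x"

definition mor_comp :: "('b, 'c) mor \<Rightarrow> ('a, 'b) mor \<Rightarrow> ('a, 'c) mor"  (infixl "\<cdot>" 70) where
  "(g \<cdot> f) n x = g n (f n x)"

text \<open>The quotient \<open>A \<times>\<^sub>G B\<close> of \<open>A \<times> B\<close> by \<open>(a \<cdot> g, b) \<sim> (a, g \<cdot> b)\<close>, for a right action \<open>r\<close> on
  \<open>A\<close> and a left action \<open>l\<close> on \<open>B\<close>. For group actions this relation is already an equivalence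
  relation, so no closure is taken.\<close>

definition bal_rel ::
  "'g set \<Rightarrow> ('a \<Rightarrow> 'g \<Rightarrow> 'a) \<Rightarrow> ('g \<Rightarrow> 'b \<Rightarrow> 'b) \<Rightarrow> 'a set \<Rightarrow> 'b set \<Rightarrow> (('a \<times> 'b) \<times> ('a \<times> 'b)) set" where
  "bal_rel G r l A B =
    {((a, b), (a', b')). a \<in> A \<and> b \<in> B \<and> a' \<in> A \<and> b' \<in> B \<and> (\<exists>g\<in>G. a = r a' g \<and> b' = l g b)}"

text \<open>For block sizes \<open>ns = [n\<^sub>0, \<dots>]\<close>, \<open>locate ns\<close> sends a position below \<open>sum_list ns\<close> to the index
  of the block containing it together with its offset in that block; \<open>position ns\<close> is the inverse.\<close>

fun locate :: "nat list \<Rightarrow> nat \<Rightarrow> nat \<times> nat" where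
  "locate [] p = (0, p)"
| "locate (n # ns) p = (if p < n then (0, p) else (case locate ns (p - n) of (i, j) \<Rightarrow> (Suc i, j)))"

definition position :: "nat list \<Rightarrow> nat \<Rightarrow> nat \<Rightarrow> nat" where
  "position ns i j = sum_list (take i ns) + j"

text \<open>The embedding of a product of symmetric groups as the Young subgroup.\<close>

definition block_sum :: "nat list \<Rightarrow> (nat \<Rightarrow> nat) list \<Rightarrow> nat \<Rightarrow> nat" where
  "block_sum ns \<tau>s p =
    (if p < sum_list ns then (case locate ns p of (i, j) \<Rightarrow> position ns i ((\<tau>s ! i) j)) else p)"

text \<open>The left action of \<open>\<pi>\<close> on lists: entry \<open>i\<close> moves to place \<open>\<pi> i\<close>.\<close>

definition move :: "(nat \<Rightarrow> nat) \<Rightarrow> 'a list \<Rightarrow> 'a list" where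
  "move \<pi> xs = permute_list (inv \<pi>) xs"

text \<open>The block permutation: it carries the \<open>i\<close>-th block of the arrangement \<open>ns\<close> to the \<open>\<pi> i\<close>-th
  block of the arrangement \<open>move \<pi> ns\<close>, preserving the order within each block.\<close>

definition block_perm :: "(nat \<Rightarrow> nat) \<Rightarrow> nat list \<Rightarrow> nat \<Rightarrow> nat" where
  "block_perm \<pi> ns p =
    (if p < sum_list ns then (case locate ns p of (i, j) \<Rightarrow> position (move \<pi> ns) (\<pi> i) j) else p)"

text \<open>The induced set of \<open>Y(n\<^sub>0) \<times> \<dots> \<times> Y(n\<^sub>k\<^sub>-\<^sub>1)\<close> along the Young subgroup of the symmetric group
  \<open>\<bbbS>\<close> on \<open>sum_list ns\<close> letters is \<open>(Y(n\<^sub>0) \<times> \<dots> \<times> Y(n\<^sub>k\<^sub>-\<^sub>1)) \<times>\<^sub>H \<bbbS>\<close>. The pair \<open>(ys, \<sigma>)\<close> stands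
  for \<open>ys \<cdot> \<sigma>\<close>.\<close>

definition ind_rel ::
  "'b scoll \<Rightarrow> nat list \<Rightarrow> (('b list \<times> (nat \<Rightarrow> nat)) \<times> ('b list \<times> (nat \<Rightarrow> nat))) set" where
  "ind_rel Y ns =
    bal_rel (listset (map Sym ns))
      (\<lambda>ys \<tau>s. map (\<lambda>i. act Y (ns ! i) (ys ! i) (\<tau>s ! i)) [0..<length ns])
      (\<lambda>\<tau>s \<sigma>. block_sum ns \<tau>s \<circ> \<sigma>)
      (listset (map (ops Y) ns))
      (Sym (sum_list ns))"

definition ind :: "'b scoll \<Rightarrow> nat list \<Rightarrow> ('b list \<times> (nat \<Rightarrow> nat)) set set" where
  "ind Y ns = (listset (map (ops Y) ns) \<times> Sym (sum_list ns)) // ind_rel Y ns"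

text \<open>The disjoint union over all \<open>n\<^sub>0 + \<dots> + n\<^sub>k\<^sub>-\<^sub>1 = n\<close>, with its left action of the symmetric group
  on \<open>k\<close> letters permuting the factors.\<close>

type_synonym 'b tup = "nat list \<times> ('b list \<times> (nat \<Rightarrow> nat)) set"

definition tuples :: "'b scoll \<Rightarrow> nat \<Rightarrow> nat \<Rightarrow> 'b tup set" where
  "tuples Y k n = (SIGMA ns : {ns. length ns = k \<and> sum_list ns = n}. ind Y ns)"

definition tup_act :: "(nat \<Rightarrow> nat) \<Rightarrow> 'b tup \<Rightarrow> 'b tup" where
  "tup_act \<pi> = (\<lambda>(ns, c). (move \<pi> ns, (\<lambda>(ys, \<sigma>). (move \<pi> ys, block_perm \<pi> ns \<circ> \<sigma>)) ` c))"

text \<open>An operation of the composition product is a number \<open>k\<close> paired with an element of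
  \<open>X(k) \<times>\<^sub>\<bbbS> tuples Y k n\<close>, where \<open>\<bbbS>\<close> is the symmetric group on \<open>k\<close> letters.\<close>

type_synonym ('a, 'b) cmp = "nat \<times> ('a \<times> 'b tup) set"

definition comp_rel :: "'a scoll \<Rightarrow> 'b scoll \<Rightarrow> nat \<Rightarrow> nat \<Rightarrow> (('a \<times> 'b tup) \<times> ('a \<times> 'b tup)) set" where
  "comp_rel X Y k n = bal_rel (Sym k) (act X k) tup_act (ops X k) (tuples Y k n)"

definition comp_prod :: "'a scoll \<Rightarrow> 'b scoll \<Rightarrow> ('a, 'b) cmp scoll"  (infixl "\<odot>" 75) where
  "X \<odot> Y =
    \<lparr>ops = (\<lambda>n. SIGMA k : UNIV. (ops X k \<times> tuples Y k n) // comp_rel X Y k n),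
     act = (\<lambda>n (k, C) \<rho>. (k, (\<lambda>(x, ns, c). (x, ns, (\<lambda>(ys, \<sigma>). (ys, \<sigma> \<circ> \<rho>)) ` c)) ` C))\<rparr>"

definition unit_coll :: "unit scoll"  ("\<I>") where
  "\<I> = \<lparr>ops = (\<lambda>n. if n = 1 then {()} else {}), act = (\<lambda>n x \<sigma>. x)\<rparr>"

text \<open>The element \<open>[x; ys \<cdot> \<sigma>]\<close> of \<open>X \<odot> Y\<close>, with \<open>ys ! i\<close> of arity \<open>ns ! i\<close>.\<close>

definition cmp_class ::
  "'a scoll \<Rightarrow> 'b scoll \<Rightarrow> 'a \<Rightarrow> nat list \<Rightarrow> 'b list \<Rightarrow> (nat \<Rightarrow> nat) \<Rightarrow> ('a, 'b) cmp" where
  "cmp_class X Y x ns ys \<sigma> =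
    (length ns, comp_rel X Y (length ns) (sum_list ns) `` {(x, ns, ind_rel Y ns `` {(ys, \<sigma>)})})"

definition reps :: "('a, 'b) cmp \<Rightarrow> ('a \<times> nat list \<times> 'b list \<times> (nat \<Rightarrow> nat)) set" where
  "reps z = {(x, ns, ys, \<sigma>). \<exists>c. (x, ns, c) \<in> snd z \<and> (ys, \<sigma>) \<in> c}"

text \<open>\<open>on_reps h z\<close> is the common value of \<open>h\<close> on all representatives of \<open>z\<close>; it is meaningful
  only if \<open>h\<close> is constant on them.\<close>

definition on_reps ::
  "('a \<Rightarrow> nat list \<Rightarrow> 'b list \<Rightarrow> (nat \<Rightarrow> nat) \<Rightarrow> 'r) \<Rightarrow> ('a, 'b) cmp \<Rightarrow> 'r" where
  "on_reps h z = the_elem ((\<lambda>(x, ns, ys, \<sigma>). h x ns ys \<sigma>) ` reps z)"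

text \<open>\<open>prod_mor X' Y' f g\<close> is \<open>f \<odot> g\<close> for \<open>f\<close> with target \<open>X'\<close> and \<open>g\<close> with target \<open>Y'\<close>.\<close>

definition prod_mor ::
  "'c scoll \<Rightarrow> 'd scoll \<Rightarrow> ('a, 'c) mor \<Rightarrow> ('b, 'd) mor \<Rightarrow> (('a, 'b) cmp, ('c, 'd) cmp) mor" where
  "prod_mor X' Y' f g n =
    on_reps (\<lambda>x ns ys \<sigma>. cmp_class X' Y' (f (length ns) x) ns (map2 g ns ys) \<sigma>)"

fun chunks :: "nat list \<Rightarrow> 'a list \<Rightarrow> 'a list list" where
  "chunks [] xs = []"
| "chunks (n # ns) xs = take n xs # chunks ns (drop n xs)"

text \<open>The associator. For \<open>w = [x; ys \<cdot> \<sigma>]\<close> an element \<open>[w; zs \<cdot> \<tau>]\<close> equals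
  \<open>[[x; ys]; zs' \<cdot> \<tau>']\<close> with \<open>zs' = move \<sigma> zs\<close> and \<open>\<tau>' = block_perm \<sigma> ms \<circ> \<tau>\<close>, where \<open>ms\<close> lists the
  arities of \<open>zs\<close>; it is sent to \<open>[x; [y\<^sub>0; zs'\<^sub>0], [y\<^sub>1; zs'\<^sub>1], \<dots>] \<cdot> \<tau>'\<close>, where \<open>zs'\<^sub>i\<close> is the chunk
  of \<open>zs'\<close> plugged into \<open>y\<^sub>i\<close>.\<close>

definition assoc ::
  "'a scoll \<Rightarrow> 'b scoll \<Rightarrow> 'c scoll \<Rightarrow> ((('a, 'b) cmp, 'c) cmp, ('a, ('b, 'c) cmp) cmp) mor" where
  "assoc X Y Z n =
    on_reps (\<lambda>w ms zs \<tau>.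
      on_reps (\<lambda>x ns ys \<sigma>.
        let mss = chunks ns (move \<sigma> ms);
            zss = chunks ns (move \<sigma> zs)
        in cmp_class X (Y \<odot> Z) x (map sum_list mss)
             (map (\<lambda>i. cmp_class Y Z (ys ! i) (mss ! i) (zss ! i) id) [0..<length ns])
             (block_perm \<sigma> ms \<circ> \<tau>)) w)"

definition lunit :: "'a scoll \<Rightarrow> ((unit, 'a) cmp, 'a) mor" where
  "lunit X n = on_reps (\<lambda>_ ns xs \<sigma>. act X n (hd xs) \<sigma>)"

definition runit :: "'a scoll \<Rightarrow> (('a, unit) cmp, 'a) mor" where
  "runit X n = on_reps (\<lambda>x ns us \<sigma>. act X n x \<sigma>)"

definition pow_coll :: "'a scoll \<Rightarrow> 'a set scoll"  ("\<P>") where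
  "\<P> X = \<lparr>ops = (\<lambda>n. Pow (ops X n)), act = (\<lambda>n A \<sigma>. (\<lambda>x. act X n x \<sigma>) ` A)\<rparr>"

definition npow_coll :: "'a scoll \<Rightarrow> 'a set scoll"  ("\<P>\<^sub>+") where
  "\<P>\<^sub>+ X = \<lparr>ops = (\<lambda>n. Pow (ops X n) - {{}}), act = (\<lambda>n A \<sigma>. (\<lambda>x. act X n x \<sigma>) ` A)\<rparr>"

definition img :: "('a, 'b) mor \<Rightarrow> ('a set, 'b set) mor" where
  "img f n A = f n ` A"

text \<open>S-collections range over all element types, and a powerset raises the type, so a natural
  transformation between functors of S-collections is a polymorphic constant and cannot be bound by
  a quantifier; hence the lax structure is given explicitly. The structure maps are
  \<open>[A; B\<^sub>0, B\<^sub>1, \<dots>] \<mapsto> {[a; b\<^sub>0, b\<^sub>1, \<dots>] | a \<in> A, b\<^sub>i \<in> B\<^sub>i}\<close> and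
  \<open>* \<mapsto> {*}\<close>; the same formulas serve both functors.\<close>

definition pow_mult :: "'a scoll \<Rightarrow> 'b scoll \<Rightarrow> (('a set, 'b set) cmp, ('a, 'b) cmp set) mor" where
  "pow_mult X Y n =
    on_reps (\<lambda>A ns Bs \<sigma>. {cmp_class X Y a ns bs \<sigma> | a bs. a \<in> A \<and> bs \<in> listset Bs})"

definition pow_unit :: "(unit, unit set) mor" where
  "pow_unit n u = {u}"

end

theory Submission
  imports Defs
begin

text \<open>The structure map sends \<open>[A; B\<^sub>0, B\<^sub>1, \<dots>]\<close> to the set of all \<open>[a; b\<^sub>0, b\<^sub>1, \<dots>]\<close> with \<open>a\<close>
chosen in \<open>A\<close> and \<open>b\<^sub>i\<close> chosen in \<open>B\<^sub>i\<close>. The symmetric groups act on subsets elementwise, so acting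
and choosing commute, and the set depends only on the class of \<open>(A; B\<^sub>0, B\<^sub>1, \<dots>)\<close>. The coherence
axioms hold because the composition product is linear: every input occurs exactly once on either
side of an axiom, so no element is chosen twice. Both sides are therefore the set of values that the
corresponding map of the composition product takes on all independent choices. Such a family of
choices exists exactly if all the sets are nonempty, which is why the nonempty subsets are preserved as well;
\<open>pw e\<close> stands for either functor, so that each axiom is proved once.

The work lies in evaluating the maps out of a composition product, which are given by the common
value on all representatives of a class. Two elementary moves generate the identifications: an
element of the symmetric group on the factors passes from the outer operation to the tuple, and a tuple of
permutations passes from the inner operations to the block sum. By \<open>on_reps_cmp_class\<close> an expression
that both moves leave unchanged may be evaluated on any representative. For the structure map, functoriality
and the unitors the invariance is a short computation. For the associator the representatives are
nested, and there are two moves at each of the two levels (\<open>reassociated_move\<close>,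
\<open>reassociated_act_middle\<close>, \<open>reassociated_act_outer\<close>, \<open>reassociated_act_inner\<close>). The moves that
interfere with the regrouping come down to identities that express block permutations
and block sums on a concatenation of lists through those on the sums of the lists:
\<open>block_perm_block_perm\<close>, \<open>block_perm_block_sum_nested\<close> and \<open>block_sum_nested\<close>. With
\<open>assoc_class\<close> the associativity axiom becomes the statement that choosing commutes with regrouping a
list into chunks.\<close>

section \<open>Permutations and their action on lists\<close>

lemma Sym_id [simp]: "id \<in> Sym n"
  by (simp add: Sym_def permutes_id)

lemma Sym_comp [intro]: "\<sigma> \<in> Sym n \<Longrightarrow> \<tau> \<in> Sym n \<Longrightarrow> \<sigma> \<circ> \<tau> \<in> Sym n"
  by (simp add: Sym_def permutes_compose)

lemma Sym_inv [intro]: "\<sigma> \<in> Sym n \<Longrightarrow> inv \<sigma> \<in> Sym n"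
  by (simp add: Sym_def permutes_inv)

lemma Sym_inv_comp: "\<sigma> \<in> Sym n \<Longrightarrow> inv \<sigma> \<circ> \<sigma> = id" "\<sigma> \<in> Sym n \<Longrightarrow> \<sigma> \<circ> inv \<sigma> = id"
  by (simp_all add: Sym_def permutes_inv_o)

lemma Sym_inverses [simp]: "\<sigma> \<in> Sym n \<Longrightarrow> inv \<sigma> (\<sigma> p) = p" "\<sigma> \<in> Sym n \<Longrightarrow> \<sigma> (inv \<sigma> p) = p"
  by (simp_all add: Sym_def permutes_inverses)

lemma Sym_less [simp]: "\<sigma> \<in> Sym n \<Longrightarrow> \<sigma> p < n \<longleftrightarrow> p < n"
  unfolding Sym_def using permutes_in_image by fastforce

lemma Sym_outside: "\<sigma> \<in> Sym n \<Longrightarrow> \<not> p < n \<Longrightarrow> \<sigma> p = p"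
  by (simp add: Sym_def permutes_def)

lemma Sym_inj: "\<sigma> \<in> Sym n \<Longrightarrow> \<sigma> p = \<sigma> q \<longleftrightarrow> p = q"
  by (metis Sym_inverses(1))

lemma SymI:
  assumes "\<And>p. p < n \<Longrightarrow> f p < n" and "\<And>p q. p < n \<Longrightarrow> q < n \<Longrightarrow> f p = f q \<Longrightarrow> p = q"
    and "\<And>p. \<not> p < n \<Longrightarrow> f p = p"
  shows "f \<in> Sym n"
proof -
  have "inj_on f {..<n}" using assms(2) by (auto intro: inj_onI)
  moreover have "f ` {..<n} \<subseteq> {..<n}" using assms(1) by auto
  ultimately have "bij_betw f {..<n} {..<n}"
    by (simp add: bij_betw_def endo_inj_surj)
  then show ?thesis unfolding Sym_def using assms(3) by (auto intro: bij_imp_permutes)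
qed

lemma length_move [simp]: "length (move \<pi> xs) = length xs"
  by (simp add: move_def)

lemma move_nth: "i < length xs \<Longrightarrow> move \<pi> xs ! i = xs ! inv \<pi> i"
  by (simp add: move_def permute_list_def)

lemma move_nth_image [simp]: "\<pi> \<in> Sym (length xs) \<Longrightarrow> i < length xs \<Longrightarrow> move \<pi> xs ! \<pi> i = xs ! i"
  by (simp add: move_nth)

text \<open>The entries of \<open>move \<pi> xs\<close> are known at the places \<open>\<pi> i\<close>, so that lists are
best compared there instead of at \<open>i\<close>.\<close>

lemma list_eq_image:
  assumes "\<pi> \<in> Sym n" "length xs = n" "length ys = n" "\<And>i. i < n \<Longrightarrow> xs ! \<pi> i = ys ! \<pi> i"
  shows "xs = ys"
proof (rule nth_equalityI)
  fix i assume "i < length xs"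
  then have "inv \<pi> i < n" using assms Sym_inv[OF assms(1)] by simp
  from assms(4)[OF this] show "xs ! i = ys ! i" using assms(1) by simp
qed (use assms in simp)

lemma move_id [simp]: "move id xs = xs"
  by (simp add: move_def)

lemma move_comp:
  assumes "\<sigma> \<in> Sym (length xs)" "\<tau> \<in> Sym (length xs)"
  shows "move (\<sigma> \<circ> \<tau>) xs = move \<sigma> (move \<tau> xs)"
proof (rule list_eq_image[OF Sym_comp[OF assms]])
  fix i assume i: "i < length xs"
  show "move (\<sigma> \<circ> \<tau>) xs ! (\<sigma> \<circ> \<tau>) i = move \<sigma> (move \<tau> xs) ! (\<sigma> \<circ> \<tau>) i"
    using i assms move_nth_image[of "\<sigma> \<circ> \<tau>" xs i] Sym_comp[OF assms] by simp
qed simp_all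

lemma move_inv [simp]:
  "\<pi> \<in> Sym (length xs) \<Longrightarrow> move \<pi> (move (inv \<pi>) xs) = xs"
  "\<pi> \<in> Sym (length xs) \<Longrightarrow> move (inv \<pi>) (move \<pi> xs) = xs"
  by (simp_all add: move_comp[symmetric] Sym_inv Sym_inv_comp)

lemma map_move: "\<pi> \<in> Sym (length xs) \<Longrightarrow> map f (move \<pi> xs) = move \<pi> (map f xs)"
  by (rule list_eq_image[of \<pi> "length xs"]) (auto simp: move_nth)

lemma map2_move:
  "\<pi> \<in> Sym (length xs) \<Longrightarrow> length ys = length xs \<Longrightarrow> map2 f (move \<pi> xs) (move \<pi> ys) = move \<pi> (map2 f xs ys)"
  by (rule list_eq_image[of \<pi> "length xs"]) (auto simp: move_nth)

lemma sum_list_move [simp]: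
  fixes xs :: "nat list" assumes "\<pi> \<in> Sym (length xs)" shows "sum_list (move \<pi> xs) = sum_list xs"
proof -
  have "mset (move \<pi> xs) = mset xs"
    using Sym_inv[OF assms] unfolding move_def Sym_def by (simp add: mset_permute_list)
  then show ?thesis by (metis sum_mset_sum_list)
qed

lemma in_listset: "xs \<in> listset As \<longleftrightarrow> length xs = length As \<and> (\<forall>i<length As. xs ! i \<in> As ! i)"
proof (induction As arbitrary: xs)
  case (Cons A As)
  show ?case
    by (cases xs) (auto simp: set_Cons_def Cons.IH nth_Cons less_Suc_eq_0_disj split: nat.splits)
qed simp

text \<open>By this the first move passes from lists of sets to the lists chosen from them.\<close>

lemma listset_move:
  assumes "\<pi> \<in> Sym (length As)" shows "listset (move \<pi> As) = move \<pi> ` listset As"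
proof (intro equalityI subsetI)
  fix zs assume zs: "zs \<in> listset (move \<pi> As)"
  have "move (inv \<pi>) zs \<in> listset As" unfolding in_listset
  proof (intro conjI allI impI)
    fix i assume i: "i < length As"
    have "\<pi> i < length As" using i assms by simp
    moreover have "inv (inv \<pi>) = \<pi>" using assms by (simp add: Sym_def permutes_inv_inv)
    ultimately have "move (inv \<pi>) zs ! i = zs ! \<pi> i" using zs i by (simp add: in_listset move_nth)
    then show "move (inv \<pi>) zs ! i \<in> As ! i"
      using zs i assms \<open>\<pi> i < _\<close> by (auto simp: in_listset dest!: spec[of _ "\<pi> i"])
  qed (use zs in \<open>simp add: in_listset\<close>)
  moreover have "zs = move \<pi> (move (inv \<pi>) zs)" using zs assms by (simp add: in_listset)
  ultimately show "zs \<in> move \<pi> ` listset As" by blast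
next
  fix zs assume "zs \<in> move \<pi> ` listset As"
  then show "zs \<in> listset (move \<pi> As)" using assms Sym_inv[OF assms]
    by (auto simp: in_listset move_nth)
qed

section \<open>Positions in a list of blocks\<close>

lemma position_0 [simp]: "position (n # ns) 0 j = j" by (simp add: position_def)

lemma position_Suc [simp]: "position (n # ns) (Suc i) j = n + position ns i j" by (simp add:
    position_def)

lemma position_less [simp]: "i < length ns \<Longrightarrow> j < ns ! i \<Longrightarrow> position ns i j < sum_list ns"
proof (induction ns arbitrary: i)
  case (Cons n ns) then show ?case by (cases i) auto
qed simp

lemma locate_position [simp]: "i < length ns \<Longrightarrow> j < ns ! i \<Longrightarrow> locate ns (position ns i j) = (i, j)"
proof (induction ns arbitrary: i)
  case (Cons n ns) then show ?case by (cases i) auto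
qed simp

text \<open>With \<open>position_eq_iff\<close> this makes \<open>position\<close> a bijection from pairs (block, offset) onto the
positions. All identities between block permutations below are verified on such pairs, where
\<open>block_sum\<close> changes the offset only and \<open>block_perm\<close> the block only.\<close>

lemma position_exhaust:
  assumes "p < sum_list ns"
  obtains i j where "i < length ns" "j < ns ! i" "p = position ns i j"
proof -
  have "\<exists>i j. i < length ns \<and> j < ns ! i \<and> p = position ns i j" using assms
  proof (induction ns arbitrary: p)
    case (Cons n ns)
    show ?case
    proof (cases "p < n")
      case True then show ?thesis by (intro exI[of _ 0] exI[of _ p]) simp
    next
      case False
      then have "p - n < sum_list ns" using Cons.prems by simp
      from Cons.IH[OF this] obtain i j where "i < length ns" "j < ns ! i" "p - n = position ns i
          j" by blast
      then show ?thesis using False by (intro exI[of _ "Suc i"] exI[of _ j]) simp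
    qed
  qed simp
  then show ?thesis using that by blast
qed

lemma position_eq_iff:
  assumes "i < length ns" "j < ns ! i" "i' < length ns" "j' < ns ! i'"
  shows "position ns i j = position ns i' j' \<longleftrightarrow> i = i' \<and> j = j'"
  using assms by (metis locate_position prod.inject)

lemma block_sum_position [simp]:
  "i < length ns \<Longrightarrow> j < ns ! i \<Longrightarrow> block_sum ns \<tau>s (position ns i j) = position ns i ((\<tau>s ! i) j)"
  by (simp add: block_sum_def)

lemma block_perm_position [simp]:
  "i < length ns \<Longrightarrow> j < ns ! i \<Longrightarrow> block_perm \<pi> ns (position ns i j) = position (move \<pi> ns) (\<pi> i) j"
  by (simp add: block_perm_def)

lemma block_sum_outside [simp]: "\<not> p < sum_list ns \<Longrightarrow> block_sum ns \<tau>s p = p"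
  by (simp add: block_sum_def)

lemma block_perm_outside [simp]: "\<not> p < sum_list ns \<Longrightarrow> block_perm \<pi> ns p = p"
  by (simp add: block_perm_def)

lemma block_ext:
  assumes "\<And>i j. i < length ns \<Longrightarrow> j < ns ! i \<Longrightarrow> f (position ns i j) = g (position ns i j)"
    and "\<And>p. \<not> p < sum_list ns \<Longrightarrow> f p = g p"
  shows "f = g"
proof
  fix p show "f p = g p" by (cases "p < sum_list ns") (auto simp: assms elim: position_exhaust)
qed

section \<open>Block sums and block permutations\<close>

abbreviation Young :: "nat list \<Rightarrow> (nat \<Rightarrow> nat) list set" where
  "Young ns \<equiv> listset (map Sym ns)"

lemma Young_iff: "\<tau>s \<in> Young ns \<longleftrightarrow> length \<tau>s = length ns \<and> (\<forall>i<length ns. \<tau>s ! i \<in> Sym (ns ! i))"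
  by (auto simp: in_listset)

lemma block_sum_Sym [intro]:
  assumes "\<tau>s \<in> Young ns" shows "block_sum ns \<tau>s \<in> Sym (sum_list ns)"
proof (rule SymI)
  fix p assume "p < sum_list ns" then show "block_sum ns \<tau>s p < sum_list ns"
    using assms by (auto simp: Young_iff elim!: position_exhaust)
next
  fix p q assume "p < sum_list ns" "q < sum_list ns" "block_sum ns \<tau>s p = block_sum ns \<tau>s q"
  then show "p = q" using assms
    by (auto simp: Young_iff position_eq_iff elim!: position_exhaust) (metis Sym_inj)
qed simp

lemma block_perm_Sym [intro]:
  assumes "\<pi> \<in> Sym (length ns)" shows "block_perm \<pi> ns \<in> Sym (sum_list ns)"
proof (rule SymI)
  fix p assume "p < sum_list ns"
  then obtain i j where ij: "i < length ns" "j < ns ! i" "p = position ns i j" by (rule position_exhaust)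
  then show "block_perm \<pi> ns p < sum_list ns"
    using assms position_less[of "\<pi> i" "move \<pi> ns" j] by simp
next
  fix p q assume "p < sum_list ns" "q < sum_list ns" "block_perm \<pi> ns p = block_perm \<pi> ns q"
  then show "p = q" using assms
    by (auto simp: position_eq_iff Sym_inj elim!: position_exhaust)
qed simp

lemma block_sum_id [simp]: "block_sum ns (map (\<lambda>_. id) ns) = id"
  by (rule block_ext[of ns]) auto

lemma block_sum_comp:
  assumes "\<tau>s \<in> Young ns" "length \<sigma>s = length ns"
  shows "block_sum ns (map2 (\<circ>) \<sigma>s \<tau>s) = block_sum ns \<sigma>s \<circ> block_sum ns \<tau>s"
  by (rule block_ext[of ns]) (use assms in \<open>auto simp: Young_iff\<close>)

lemma block_perm_id [simp]: "block_perm id ns = id"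
  by (rule block_ext[of ns]) auto

lemma block_perm_comp:
  assumes "\<sigma> \<in> Sym (length ns)" "\<tau> \<in> Sym (length ns)"
  shows "block_perm (\<sigma> \<circ> \<tau>) ns = block_perm \<sigma> (move \<tau> ns) \<circ> block_perm \<tau> ns"
  by (rule block_ext[of ns]) (use assms in \<open>auto simp: move_comp\<close>)

text \<open>On pairs (block, offset) the two permutations act on different components and commute; what
changes is the order in which the blocks, and with them the permutations \<open>\<tau>s\<close>, are listed.\<close>

lemma block_perm_block_sum:
  assumes "\<pi> \<in> Sym (length ns)" "\<tau>s \<in> Young ns"
  shows "block_perm \<pi> ns \<circ> block_sum ns \<tau>s = block_sum (move \<pi> ns) (move \<pi> \<tau>s) \<circ> block_perm \<pi> ns"
  by (rule block_ext[of ns]) (use assms in \<open>auto simp: Young_iff\<close>)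

section \<open>Blocks of blocks\<close>

lemma chunks_concat [simp]: "chunks (map length xss) (concat xss) = xss"
  by (induction xss) auto

lemma concat_chunks:
  "length xs = sum_list ns \<Longrightarrow> concat (chunks ns xs) = xs \<and> map length (chunks ns xs) = ns"
  by (induction ns arbitrary: xs) auto

lemma concat_nth [simp]:
  "i < length xss \<Longrightarrow> j < length (xss ! i) \<Longrightarrow> concat xss ! position (map length xss) i j = xss ! i ! j"
proof (induction xss arbitrary: i)
  case (Cons n ns) then show ?case by (cases i) (auto simp: nth_append)
qed simp

text \<open>The two ways of addressing a letter in a list of lists of blocks: block number \<open>(i, j)\<close> of
the concatenation and offset \<open>q\<close>, or superblock \<open>i\<close>, its block \<open>j\<close> and offset \<open>q\<close>. Every identity on
nested blocks follows by switching between them.\<close>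

lemma position_nested:
  "i < length mss \<Longrightarrow> j < length (mss ! i) \<Longrightarrow>
   position (concat mss) (position (map length mss) i j) q
     = position (map sum_list mss) i (position (mss ! i) j q)"
proof (induction mss arbitrary: i)
  case (Cons m ms) then show ?case by (cases i) (auto simp: position_def)
qed simp

lemma sum_concat: "sum_list (concat mss) = sum_list (map sum_list (mss :: nat list list))"
  by (induction mss) auto

lemma block_ext_nested:
  fixes mss :: "nat list list"
  assumes "\<And>i j q. i < length mss \<Longrightarrow> j < length (mss ! i) \<Longrightarrow> q < mss ! i ! j \<Longrightarrow>
      f (position (map sum_list mss) i (position (mss ! i) j q))
      = g (position (map sum_list mss) i (position (mss ! i) j q))"
    and "\<And>p. \<not> p < sum_list (concat mss) \<Longrightarrow> f p = g p"
  shows "f = g"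
proof (rule block_ext[of "map sum_list mss"])
  fix i p assume "i < length (map sum_list mss)" "p < map sum_list mss ! i"
  then show "f (position (map sum_list mss) i p) = g (position (map sum_list mss) i p)"
    using assms(1) by (auto elim!: position_exhaust)
qed (use assms(2) in \<open>simp add: sum_concat\<close>)

lemma concat_move:
  assumes "\<pi> \<in> Sym (length xss)"
  shows "concat (move \<pi> xss) = move (block_perm \<pi> (map length xss)) (concat xss)"
proof -
  have bp: "block_perm \<pi> (map length xss) \<in> Sym (length (concat xss))"
    using block_perm_Sym[of \<pi> "map length xss"] assms by (simp add: length_concat)
  show ?thesis
  proof (rule list_eq_image[OF bp])
    fix p assume "p < length (concat xss)"
    then have "p < sum_list (map length xss)" by (simp add: length_concat)
    then obtain i j where ij: "i < length xss" "j < length (xss ! i)" "p = position (map length xss) i j"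
      by (auto elim!: position_exhaust)
    have "concat (move \<pi> xss) ! block_perm \<pi> (map length xss) p = xss ! i ! j"
      using ij assms concat_nth[of "\<pi> i" "move \<pi> xss" j] by (simp add: map_move)
    then show "concat (move \<pi> xss) ! block_perm \<pi> (map length xss) p
        = move (block_perm \<pi> (map length xss)) (concat xss) ! block_perm \<pi> (map length xss) p"
      using move_nth_image[OF bp \<open>p < length (concat xss)\<close>] ij by simp
  qed (use assms in \<open>simp_all add: length_concat map_move\<close>)
qed

lemma concat_map2_move:
  assumes "\<tau>s \<in> Young (map length xss)"
  shows "concat (map2 move \<tau>s xss) = move (block_sum (map length xss) \<tau>s) (concat xss)"
proof -
  have bs: "block_sum (map length xss) \<tau>s \<in> Sym (length (concat xss))"
    using block_sum_Sym[OF assms] by (simp add: length_concat)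
  have len: "map length (map2 move \<tau>s xss) = map length xss"
    using assms by (auto simp: in_listset intro!: nth_equalityI)
  show ?thesis
  proof (rule list_eq_image[OF bs])
    fix p assume p: "p < length (concat xss)"
    then have "p < sum_list (map length xss)" by (simp add: length_concat)
    then obtain i j where ij: "i < length xss" "j < length (xss ! i)" "p = position (map length xss) i j"
      by (auto elim!: position_exhaust)
    have "concat (map2 move \<tau>s xss) ! block_sum (map length xss) \<tau>s p = xss ! i ! j"
      using ij assms concat_nth[of i "map2 move \<tau>s xss" "(\<tau>s ! i) j", unfolded len] by (simp add:
          in_listset)
    then show "concat (map2 move \<tau>s xss) ! block_sum (map length xss) \<tau>s p
        = move (block_sum (map length xss) \<tau>s) (concat xss) ! block_sum (map length xss) \<tau>s p"
      using move_nth_image[OF bs p] ij by simp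
  qed (simp_all add: length_concat len del: map_map)
qed

text \<open>The inner block permutation keeps the members of each list of \<open>mss\<close> together and in order, so
the outer one carries the superblocks along as a whole.\<close>

lemma block_perm_block_perm:
  assumes "\<pi> \<in> Sym (length mss)"
  shows "block_perm (block_perm \<pi> (map length mss)) (concat mss) = block_perm \<pi> (map sum_list mss)"
proof (rule block_ext_nested[of mss])
  fix i j q assume a: "i < length mss" "j < length (mss ! i)" "q < mss ! i ! j"
  have "block_perm (block_perm \<pi> (map length mss)) (concat mss) (position (concat mss) (position
      (map length mss) i j) q)
     = position (concat (move \<pi> mss)) (position (map length (move \<pi> mss)) (\<pi> i) j) q"
    using a assms position_less[of i "map length mss" j]
    by (simp add: concat_move map_move length_concat)
  also have "\<dots> = position (map sum_list (move \<pi> mss)) (\<pi> i) (position (mss ! i) j q)"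
    using a assms by (simp add: position_nested)
  finally show "block_perm (block_perm \<pi> (map length mss)) (concat mss)
        (position (map sum_list mss) i (position (mss ! i) j q))
      = block_perm \<pi> (map sum_list mss) (position (map sum_list mss) i (position (mss ! i) j q))"
    using a assms by (simp add: position_nested map_move)
qed (simp_all add: sum_concat)

text \<open>The inner block sum stays inside each list of \<open>mss\<close>, so the blocks are permuted within their
superblock.\<close>

lemma block_perm_block_sum_nested:
  assumes "\<tau>s \<in> Young (map length mss)"
  shows "block_perm (block_sum (map length mss) \<tau>s) (concat mss)
    = block_sum (map sum_list mss) (map2 block_perm \<tau>s mss)"
proof (rule block_ext_nested[of mss])
  fix i j q assume a: "i < length mss" "j < length (mss ! i)" "q < mss ! i ! j"
  have len: "map length (map2 move \<tau>s mss) = map length mss"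
    using assms by (auto simp: in_listset intro!: nth_equalityI)
  have sl: "map sum_list (map2 move \<tau>s mss) = map sum_list mss"
    using assms by (auto simp: in_listset intro!: nth_equalityI)
  have "block_perm (block_sum (map length mss) \<tau>s) (concat mss) (position (concat mss) (position
      (map length mss) i j) q)
     = position (concat (map2 move \<tau>s mss)) (position (map length (map2 move \<tau>s mss)) i ((\<tau>s ! i) j)) q"
    using a assms position_less[of i "map length mss" j]
    by (simp add: concat_map2_move len length_concat del: map_map)
  also have "\<dots> = position (map sum_list mss) i (position (move (\<tau>s ! i) (mss ! i)) ((\<tau>s ! i) j) q)"
    using a assms by (subst position_nested) (simp_all add: sl Young_iff del: map_map)
  finally show "block_perm (block_sum (map length mss) \<tau>s) (concat mss)
        (position (map sum_list mss) i (position (mss ! i) j q))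
      = block_sum (map sum_list mss) (map2 block_perm \<tau>s mss) (position (map sum_list mss) i
          (position (mss ! i) j q))"
    using a assms by (simp add: position_nested in_listset)
qed (simp_all add: sum_concat)

text \<open>A block sum is formed letterwise inside each block, so that it can be formed in one step or first
within the superblocks.\<close>

lemma block_sum_nested:
  assumes "length \<tau>ss = length mss" "\<And>i. i < length mss \<Longrightarrow> \<tau>ss ! i \<in> Young (mss ! i)"
  shows "block_sum (concat mss) (concat \<tau>ss) = block_sum (map sum_list mss) (map2 block_sum mss \<tau>ss)"
proof (rule block_ext_nested[of mss])
  fix i j q assume a: "i < length mss" "j < length (mss ! i)" "q < mss ! i ! j"
  have len: "map length \<tau>ss = map length mss"
    using assms by (auto simp: Young_iff intro!: nth_equalityI)
  have "block_sum (concat mss) (concat \<tau>ss) (position (concat mss) (position (map length mss) i j) q)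
     = position (concat mss) (position (map length mss) i j) ((\<tau>ss ! i ! j) q)"
    using a assms position_less[of i "map length mss" j] concat_nth[of i \<tau>ss j, unfolded len]
    by (simp add: length_concat Young_iff)
  then show "block_sum (concat mss) (concat \<tau>ss) (position (map sum_list mss) i (position (mss ! i) j q))
      = block_sum (map sum_list mss) (map2 block_sum mss \<tau>ss) (position (map sum_list mss) i
          (position (mss ! i) j q))"
    using a assms by (simp add: position_nested in_listset)
qed (simp_all add: sum_concat)

section \<open>Balanced products\<close>

text \<open>The setting in which \<open>bal_rel\<close> is an equivalence relation without taking a closure: a right
and a left action of the same group. It is used for the symmetric group that permutes the factors of a
tuple and for the Young subgroup in an induced set.\<close>

locale balanced =
  fixes G :: "'g set" and m :: "'g \<Rightarrow> 'g \<Rightarrow> 'g" and e :: 'g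
    and r :: "'a \<Rightarrow> 'g \<Rightarrow> 'a" and l :: "'g \<Rightarrow> 'b \<Rightarrow> 'b" and A :: "'a set" and B :: "'b set"
  assumes unit: "e \<in> G"
    and mult: "g \<in> G \<Longrightarrow> h \<in> G \<Longrightarrow> m g h \<in> G"
    and inverse: "g \<in> G \<Longrightarrow> \<exists>h\<in>G. m g h = e \<and> m h g = e"
    and r_closed: "a \<in> A \<Longrightarrow> g \<in> G \<Longrightarrow> r a g \<in> A"
    and r_unit: "a \<in> A \<Longrightarrow> r a e = a"
    and r_mult: "a \<in> A \<Longrightarrow> g \<in> G \<Longrightarrow> h \<in> G \<Longrightarrow> r (r a g) h = r a (m g h)"
    and l_closed: "b \<in> B \<Longrightarrow> g \<in> G \<Longrightarrow> l g b \<in> B"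
    and l_unit: "b \<in> B \<Longrightarrow> l e b = b"
    and l_mult: "b \<in> B \<Longrightarrow> g \<in> G \<Longrightarrow> h \<in> G \<Longrightarrow> l g (l h b) = l (m g h) b"
begin

lemma bal_rel_equiv: "equiv (A \<times> B) (bal_rel G r l A B)"
proof (intro equivI refl_onI symI transI)
  show "bal_rel G r l A B \<subseteq> (A \<times> B) \<times> (A \<times> B)" by (auto simp: bal_rel_def)
  fix p assume "p \<in> A \<times> B"
  then show "(p, p) \<in> bal_rel G r l A B"
    using unit by (auto simp: bal_rel_def r_unit l_unit intro!: bexI[of _ e])
next
  fix p q assume "(p, q) \<in> bal_rel G r l A B"
  then obtain a b a' b' g where *: "p = (a, b)" "q = (a', b')" "a \<in> A" "b \<in> B" "a' \<in> A" "b' \<in> B" "g \<in> G"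
    "a = r a' g" "b' = l g b" by (auto simp: bal_rel_def)
  obtain h where h: "h \<in> G" "m g h = e" "m h g = e" using inverse[OF \<open>g \<in> G\<close>] by blast
  have "a' = r a h" using * h by (simp add: r_mult r_unit)
  moreover have "b = l h b'" using * h by (simp add: l_mult l_unit)
  ultimately show "(q, p) \<in> bal_rel G r l A B" using * h unfolding bal_rel_def by blast
next
  fix p q s assume "(p, q) \<in> bal_rel G r l A B" "(q, s) \<in> bal_rel G r l A B"
  then obtain a b a' b' a'' b'' g h where *: "p = (a, b)" "q = (a', b')" "s = (a'', b'')"
    "a \<in> A" "b \<in> B" "a' \<in> A" "b' \<in> B" "a'' \<in> A" "b'' \<in> B" "g \<in> G" "h \<in> G"
    "a = r a' g" "b' = l g b" "a' = r a'' h" "b'' = l h b'" by (auto simp: bal_rel_def)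
  have "a = r a'' (m h g)" "b'' = l (m h g) b" using * by (simp_all add: r_mult l_mult)
  then show "(p, s) \<in> bal_rel G r l A B" using * mult[of h g] unfolding bal_rel_def by blast
qed

text \<open>The defining identification of a balanced product; each of the two moves between
representatives of a composite is an instance.\<close>

lemma bal_rel_slide:
  assumes "a \<in> A" "b \<in> B" "g \<in> G"
  shows "bal_rel G r l A B `` {(r a g, b)} = bal_rel G r l A B `` {(a, l g b)}"
  by (rule equiv_class_eq[OF bal_rel_equiv])
    (use assms in \<open>auto simp: bal_rel_def r_closed l_closed\<close>)

end

section \<open>Representatives of composites\<close>

definition act_list :: "'b scoll \<Rightarrow> nat list \<Rightarrow> 'b list \<Rightarrow> (nat \<Rightarrow> nat) list \<Rightarrow> 'b list" where
  "act_list Y ns ys \<tau>s = map (\<lambda>i. act Y (ns ! i) (ys ! i) (\<tau>s ! i)) [0..<length ns]"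

abbreviation inputs :: "'b scoll \<Rightarrow> nat list \<Rightarrow> 'b list set" where
  "inputs Y ns \<equiv> listset (map (ops Y) ns)"

lemma act_closed: "s_collection X \<Longrightarrow> x \<in> ops X n \<Longrightarrow> \<sigma> \<in> Sym n \<Longrightarrow> act X n x \<sigma> \<in> ops X n"
  by (simp add: s_collection_def)

lemma act_id: "s_collection X \<Longrightarrow> x \<in> ops X n \<Longrightarrow> act X n x id = x"
  by (simp add: s_collection_def)

lemma act_comp: "s_collection X \<Longrightarrow> x \<in> ops X n \<Longrightarrow> \<sigma> \<in> Sym n \<Longrightarrow> \<tau> \<in> Sym n \<Longrightarrow>
  act X n (act X n x \<sigma>) \<tau> = act X n x (\<sigma> \<circ> \<tau>)"
  by (simp add: s_collection_def)

lemma length_act_list [simp]: "length (act_list Y ns ys \<tau>s) = length ns"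
  by (simp add: act_list_def)

lemma act_list_nth [simp]: "i < length ns \<Longrightarrow> act_list Y ns ys \<tau>s ! i = act Y (ns ! i) (ys ! i) (\<tau>s ! i)"
  by (simp add: act_list_def)

lemma move_act_list:
  assumes "\<pi> \<in> Sym (length ns)" "length ys = length ns" "length \<tau>s = length ns"
  shows "move \<pi> (act_list Y ns ys \<tau>s) = act_list Y (move \<pi> ns) (move \<pi> ys) (move \<pi> \<tau>s)"
  by (rule list_eq_image[OF assms(1)]) (use assms in simp_all)

lemma inputs_move:
  assumes "\<pi> \<in> Sym (length ns)"
  shows "inputs Y (move \<pi> ns) = move \<pi> ` inputs Y ns" "Young (move \<pi> ns) = move \<pi> ` Young ns"
  using assms by (simp_all add: map_move listset_move)

text \<open>The Young subgroup is a product of symmetric groups, so its multiplication is entrywise.\<close>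

lemma ind_rel_balanced:
  assumes Y: "s_collection Y"
  shows "balanced (Young ns) (map2 (\<circ>)) (map (\<lambda>_. id) ns) (act_list Y ns) (\<lambda>\<tau>s \<sigma>. block_sum ns \<tau>s \<circ> \<sigma>)
    (inputs Y ns) (Sym (sum_list ns))"
proof
  fix g assume g: "g \<in> Young ns"
  show "\<exists>h\<in>Young ns. map2 (\<circ>) g h = map (\<lambda>_. id) ns \<and> map2 (\<circ>) h g = map (\<lambda>_. id) ns"
    using g by (intro bexI[of _ "map inv g"])
      (auto simp: Young_iff Sym_inv Sym_inv_comp intro!: nth_equalityI)
qed (auto simp: in_listset Y act_closed act_id act_comp block_sum_Sym block_sum_comp comp_assoc
   intro!: nth_equalityI Sym_comp block_sum_Sym)

lemma ind_rel_alt: "ind_rel Y ns = bal_rel (Young ns) (act_list Y ns) (\<lambda>\<tau>s \<sigma>. block_sum ns \<tau>s \<circ> \<sigma>)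
    (inputs Y ns) (Sym (sum_list ns))"
  unfolding ind_rel_def act_list_def ..

lemma ind_rel_iff: "((ys, \<sigma>), (ys', \<sigma>')) \<in> ind_rel Y ns \<longleftrightarrow> ys \<in> inputs Y ns \<and> \<sigma> \<in> Sym (sum_list ns) \<and>
   ys' \<in> inputs Y ns \<and> \<sigma>' \<in> Sym (sum_list ns) \<and> (\<exists>\<tau>s\<in>Young ns. ys = act_list Y ns ys' \<tau>s \<and> \<sigma>' =
       block_sum ns \<tau>s \<circ> \<sigma>)"
  unfolding ind_rel_alt bal_rel_def by simp

abbreviation ind_class :: "'b scoll \<Rightarrow> nat list \<Rightarrow> 'b list \<Rightarrow> (nat \<Rightarrow> nat) \<Rightarrow> ('b list \<times> (nat \<Rightarrow> nat))
    set" where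
  "ind_class Y ns ys \<sigma> \<equiv> ind_rel Y ns `` {(ys, \<sigma>)}"

lemma tuples_iff: "(ns, c) \<in> tuples Y k n \<longleftrightarrow> length ns = k \<and> sum_list ns = n \<and>
   (\<exists>ys\<in>inputs Y ns. \<exists>\<sigma>\<in>Sym n. c = ind_class Y ns ys \<sigma>)"
  by (auto simp: tuples_def ind_def quotient_def)

text \<open>Since \<open>block_perm \<pi> ns\<close> carries the Young subgroup of \<open>ns\<close> to the one of \<open>move \<pi> ns\<close>,
equivalent arrangements have equivalent images; since \<open>move \<pi>\<close> is a bijection, every member of
the target class is reached. Hence \<open>tup_act\<close> may be computed on a representative.\<close>

lemma tup_act_class:
  assumes Y: "s_collection Y" and pi: "\<pi> \<in> Sym (length ns)" and ys: "ys \<in> inputs Y ns" and sigma: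
      "\<sigma> \<in> Sym (sum_list ns)"
  shows "tup_act \<pi> (ns, ind_class Y ns ys \<sigma>) = (move \<pi> ns, ind_class Y (move \<pi> ns) (move \<pi> ys)
      (block_perm \<pi> ns \<circ> \<sigma>))"
proof -
  let ?T = "\<lambda>(ys, \<sigma>). (move \<pi> ys, block_perm \<pi> ns \<circ> \<sigma>)"
  have S: "block_perm \<pi> ns \<circ> \<sigma> \<in> Sym (sum_list ns)" if "\<sigma> \<in> Sym (sum_list ns)" for \<sigma>
    using that pi by blast
  have "?T ` ind_class Y ns ys \<sigma> = ind_class Y (move \<pi> ns) (move \<pi> ys) (block_perm \<pi> ns \<circ> \<sigma>)"
  proof (intro equalityI subsetI)
    fix t assume "t \<in> ?T ` ind_class Y ns ys \<sigma>"
    then obtain ys' \<sigma>' \<tau>s where *: "t = (move \<pi> ys', block_perm \<pi> ns \<circ> \<sigma>')" "ys' \<in> inputs Y ns"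
      "\<sigma>' \<in> Sym (sum_list ns)" "\<tau>s \<in> Young ns" "ys = act_list Y ns ys' \<tau>s" "\<sigma>' = block_sum ns \<tau>s \<circ> \<sigma>"
      by (auto simp: ind_rel_iff)
    have "move \<pi> ys = act_list Y (move \<pi> ns) (move \<pi> ys') (move \<pi> \<tau>s)"
      using * pi by (simp add: move_act_list in_listset)
    moreover have "block_perm \<pi> ns \<circ> \<sigma>' = block_sum (move \<pi> ns) (move \<pi> \<tau>s) \<circ> (block_perm \<pi> ns \<circ> \<sigma>)"
      using block_perm_block_sum[OF pi *(4)] * by (simp add: comp_assoc[symmetric])
    ultimately show "t \<in> ind_class Y (move \<pi> ns) (move \<pi> ys) (block_perm \<pi> ns \<circ> \<sigma>)"
      unfolding *(1) Image_singleton_iff ind_rel_iff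
      using imageI[OF *(2), of "move \<pi>"] imageI[OF *(4), of "move \<pi>"] imageI[OF ys, of "move \<pi>"]
        S[OF sigma] S[OF *(3)] pi by (intro conjI bexI[of _ "move \<pi> \<tau>s"]) (simp_all add: inputs_move)
  next
    fix t assume "t \<in> ind_class Y (move \<pi> ns) (move \<pi> ys) (block_perm \<pi> ns \<circ> \<sigma>)"
    then obtain ys' \<tau>s where *: "t = (move \<pi> ys', block_sum (move \<pi> ns) (move \<pi> \<tau>s) \<circ> (block_perm
        \<pi> ns \<circ> \<sigma>))"
      "ys' \<in> inputs Y ns" "\<tau>s \<in> Young ns" "move \<pi> ys = act_list Y (move \<pi> ns) (move \<pi> ys') (move \<pi> \<tau>s)"
      using pi by (cases t) (auto simp: ind_rel_iff inputs_move)
    have "move \<pi> ys = move \<pi> (act_list Y ns ys' \<tau>s)"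
      using * pi by (simp add: move_act_list in_listset)
    then have "move (inv \<pi>) (move \<pi> ys) = move (inv \<pi>) (move \<pi> (act_list Y ns ys' \<tau>s))" by simp
    then have "ys = act_list Y ns ys' \<tau>s" using pi ys by (simp add: in_listset)
    then have "(ys', block_sum ns \<tau>s \<circ> \<sigma>) \<in> ind_class Y ns ys \<sigma>"
      using * ys sigma by (auto simp: ind_rel_iff)
    moreover have "t = ?T (ys', block_sum ns \<tau>s \<circ> \<sigma>)"
      using block_perm_block_sum[OF pi *(3)] * by (simp add: comp_assoc[symmetric])
    ultimately show "t \<in> ?T ` ind_class Y ns ys \<sigma>" by (rule rev_image_eqI)
  qed
  then show ?thesis by (simp add: tup_act_def)
qed

lemma comp_rel_balanced:
  assumes X: "s_collection X" and Y: "s_collection Y"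
  shows "balanced (Sym k) (\<circ>) id (act X k) tup_act (ops X k) (tuples Y k n)"
proof
  fix g assume "g \<in> Sym k"
  then show "\<exists>h\<in>Sym k. g \<circ> h = id \<and> h \<circ> g = id"
    by (intro bexI[of _ "inv g"]) (auto simp: Sym_inv_comp)
next
  fix t g assume "t \<in> tuples Y k n" and g: "g \<in> Sym k"
  then obtain ns ys \<sigma> where t: "t = (ns, ind_class Y ns ys \<sigma>)" "length ns = k" "sum_list ns = n"
    "ys \<in> inputs Y ns" "\<sigma> \<in> Sym (sum_list ns)" by (cases t) (auto simp: tuples_iff)
  show "tup_act g t \<in> tuples Y k n"
    using t g by (auto simp: tup_act_class[OF Y] tuples_iff inputs_move)
  fix h assume h: "h \<in> Sym k"
  show "tup_act g (tup_act h t) = tup_act (g \<circ> h) t"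
    using t g h Sym_comp[OF g h] block_perm_Sym[of h ns]
    by (simp add: tup_act_class[OF Y] inputs_move Sym_comp move_comp block_perm_comp comp_assoc
        in_listset)
next
  fix t assume "t \<in> tuples Y k n"
  then show "tup_act id t = t" by (cases t) (auto simp: tup_act_def)
qed (auto simp: X act_closed act_id act_comp)

definition is_rep where
  "is_rep X Y x ns ys \<sigma> \<longleftrightarrow> x \<in> ops X (length ns) \<and> ys \<in> inputs Y ns \<and> \<sigma> \<in> Sym (sum_list ns)"

text \<open>The first move: a permutation of the factors passes from the outer operation to the tuple.\<close>

lemma cmp_class_move:
  assumes "s_collection X" "s_collection Y" "is_rep X Y x ns ys \<sigma>" "\<pi> \<in> Sym (length ns)"
  shows "cmp_class X Y (act X (length ns) x \<pi>) ns ys \<sigma> = cmp_class X Y x (move \<pi> ns) (move \<pi> ys)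
      (block_perm \<pi> ns \<circ> \<sigma>)"
  using balanced.bal_rel_slide[OF comp_rel_balanced[OF assms(1,2), of "length ns" "sum_list ns"],
      of x "(ns, ind_class Y ns ys \<sigma>)" \<pi>] assms
  by (auto simp: cmp_class_def comp_rel_def is_rep_def tuples_iff tup_act_class)

text \<open>The second move: permutations of the inputs of the inner operations pass to their block sum.\<close>

lemma cmp_class_act_list:
  assumes "s_collection Y" "is_rep X Y x ns ys \<sigma>" "\<tau>s \<in> Young ns"
  shows "cmp_class X Y x ns (act_list Y ns ys \<tau>s) \<sigma> = cmp_class X Y x ns ys (block_sum ns \<tau>s \<circ> \<sigma>)"
  using balanced.bal_rel_slide[OF ind_rel_balanced[OF assms(1), of ns], of ys \<sigma> \<tau>s] assms(2,3)
  by (simp add: cmp_class_def ind_rel_alt is_rep_def)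

lemma comp_ops_exhaust:
  assumes "z \<in> ops (X \<odot> Y) n"
  obtains x ns ys \<sigma> where "is_rep X Y x ns ys \<sigma>" "sum_list ns = n" "z = cmp_class X Y x ns ys \<sigma>"
  using assms by (auto simp: comp_prod_def quotient_def tuples_iff is_rep_def cmp_class_def)

lemma cmp_class_ops:
  assumes "is_rep X Y x ns ys \<sigma>" "sum_list ns = n"
  shows "cmp_class X Y x ns ys \<sigma> \<in> ops (X \<odot> Y) n"
proof -
  have "(ns, ind_class Y ns ys \<sigma>) \<in> tuples Y (length ns) n"
    using assms by (auto simp: tuples_iff is_rep_def)
  then show ?thesis
    using assms by (auto simp: comp_prod_def cmp_class_def is_rep_def intro!: quotientI)
qed

text \<open>Any representative arises from a given one by the second move followed by the first, so an
expression that is invariant under both moves is constant on representatives. Length and sum of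
the list of arities are the same for all representatives; the invariance is only asked for those,
because the unitors are invariant only in the given arity.\<close>

lemma on_reps_cmp_class:
  assumes X: "s_collection X" and Y: "s_collection Y" and rep: "is_rep X Y x ns ys \<sigma>"
    and move: "\<And>x ns' ys \<sigma> \<pi>. is_rep X Y x ns' ys \<sigma> \<Longrightarrow> length ns' = length ns \<Longrightarrow> sum_list ns' =
        sum_list ns \<Longrightarrow>
       \<pi> \<in> Sym (length ns) \<Longrightarrow>
       h (act X (length ns) x \<pi>) ns' ys \<sigma> = h x (move \<pi> ns') (move \<pi> ys) (block_perm \<pi> ns' \<circ> \<sigma>)"
    and act: "\<And>x ns' ys \<sigma> \<tau>s. is_rep X Y x ns' ys \<sigma> \<Longrightarrow> length ns' = length ns \<Longrightarrow> sum_list ns' =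
        sum_list ns \<Longrightarrow>
       \<tau>s \<in> Young ns' \<Longrightarrow> h x ns' (act_list Y ns' ys \<tau>s) \<sigma> = h x ns' ys (block_sum ns' \<tau>s \<circ> \<sigma>)"
  shows "on_reps h (cmp_class X Y x ns ys \<sigma>) = h x ns ys \<sigma>"
proof -
  let ?z = "cmp_class X Y x ns ys \<sigma>"
  have self: "(x, ns, ys, \<sigma>) \<in> reps ?z"
  proof -
    have "(ys, \<sigma>) \<in> ind_class Y ns ys \<sigma>"
      using equiv_class_self[OF balanced.bal_rel_equiv[OF ind_rel_balanced[OF Y]]] rep
      by (auto simp: ind_rel_alt is_rep_def)
    moreover have "(x, ns, ind_class Y ns ys \<sigma>) \<in> comp_rel X Y (length ns) (sum_list ns) `` {(x,
        ns, ind_class Y ns ys \<sigma>)}"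
      unfolding comp_rel_def
      by (rule equiv_class_self[OF balanced.bal_rel_equiv[OF comp_rel_balanced[OF X Y]]])
        (use rep in \<open>auto simp: is_rep_def tuples_iff\<close>)
    ultimately show ?thesis by (auto simp: reps_def cmp_class_def)
  qed
  have const: "h x' ns' ys' \<sigma>' = h x ns ys \<sigma>" if "(x', ns', ys', \<sigma>') \<in> reps ?z" for x' ns' ys' \<sigma>'
  proof -
    from that obtain c \<pi> where c: "(ys', \<sigma>') \<in> c" "x' \<in> ops X (length ns)" "x = act X (length ns) x' \<pi>"
      "\<pi> \<in> Sym (length ns)" "(ns', c) = tup_act \<pi> (ns, ind_class Y ns ys \<sigma>)"
      by (auto simp: reps_def cmp_class_def comp_rel_def bal_rel_def)
    then obtain ys1 \<sigma>1 where 1: "(ys1, \<sigma>1) \<in> ind_class Y ns ys \<sigma>" "ns' = move \<pi> ns" "ys' = move \<pi> ys1"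
      "\<sigma>' = block_perm \<pi> ns \<circ> \<sigma>1" by (auto simp: tup_act_def)
    then obtain \<tau>s where 2: "\<tau>s \<in> Young ns" "ys = act_list Y ns ys1 \<tau>s" "\<sigma>1 = block_sum ns \<tau>s \<circ> \<sigma>"
      "ys1 \<in> inputs Y ns" "\<sigma>1 \<in> Sym (sum_list ns)" by (auto simp: ind_rel_iff)
    have "h x ns ys \<sigma> = h x ns ys1 \<sigma>1"
      unfolding 2 using act[of x ns ys1 \<sigma> \<tau>s] rep 2 by (simp add: is_rep_def)
    also have "\<dots> = h x' ns' ys' \<sigma>'"
      unfolding 1 c(3) using move[of x' ns ys1 \<sigma>1 \<pi>] c 2 by (simp add: is_rep_def)
    finally show ?thesis ..
  qed
  have "the_elem ((\<lambda>(x, ns, ys, \<sigma>). h x ns ys \<sigma>) ` reps ?z) = (\<lambda>(x, ns, ys, \<sigma>). h x ns ys \<sigma>) (x,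
      ns, ys, \<sigma>)"
  proof (rule the_elem_image_unique)
    show "reps ?z \<noteq> {}" using self by blast
    fix q assume "q \<in> reps ?z"
    then show "(\<lambda>(x, ns, ys, \<sigma>). h x ns ys \<sigma>) q = (\<lambda>(x, ns, ys, \<sigma>). h x ns ys \<sigma>) (x, ns, ys, \<sigma>)"
      using const[of "fst q" "fst (snd q)" "fst (snd (snd q))" "snd (snd (snd q))"]
      by (simp only: prod.collapse split_beta fst_conv snd_conv)
  qed
  then show ?thesis by (simp add: on_reps_def)
qed

section \<open>The composition product is a collection\<close>

text \<open>Both inclusions between the class of a composite and its translate by a permutation
can be read off this parametrization, as the parameters do not involve \<open>\<sigma>\<close>.\<close>

lemma comp_rel_class:
  assumes "s_collection X" "s_collection Y" "is_rep X Y x ns ys \<sigma>"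
  shows "comp_rel X Y (length ns) (sum_list ns) `` {(x, ns, ind_class Y ns ys \<sigma>)} =
    (\<lambda>(x', \<pi>). (x', move \<pi> ns, ind_class Y (move \<pi> ns) (move \<pi> ys) (block_perm \<pi> ns \<circ> \<sigma>))) `
      {(x', \<pi>). x' \<in> ops X (length ns) \<and> \<pi> \<in> Sym (length ns) \<and> x = act X (length ns) x' \<pi>}"
    (is "_ = ?f ` ?S")
proof -
  have t: "(ns, ind_class Y ns ys \<sigma>) \<in> tuples Y (length ns) (sum_list ns)"
    using assms by (auto simp: tuples_iff is_rep_def)
  have eq: "tup_act \<pi> (ns, ind_class Y ns ys \<sigma>)
      = (move \<pi> ns, ind_class Y (move \<pi> ns) (move \<pi> ys) (block_perm \<pi> ns \<circ> \<sigma>))" if "\<pi> \<in> Sym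
          (length ns)" for \<pi>
    using assms that by (simp add: tup_act_class is_rep_def)
  show ?thesis
  proof (intro equalityI subsetI)
    fix q assume "q \<in> comp_rel X Y (length ns) (sum_list ns) `` {(x, ns, ind_class Y ns ys \<sigma>)}"
    then obtain x' \<pi> where "q = (x', tup_act \<pi> (ns, ind_class Y ns ys \<sigma>))" "(x', \<pi>) \<in> ?S"
      by (cases q) (auto simp: comp_rel_def bal_rel_def)
    then show "q \<in> ?f ` ?S" using eq by (intro image_eqI[of _ _ "(x', \<pi>)"]) auto
  next
    fix q assume "q \<in> ?f ` ?S"
    then obtain x' \<pi> where q: "q = (x', tup_act \<pi> (ns, ind_class Y ns ys \<sigma>))" and S: "(x', \<pi>) \<in> ?S"
      using eq by auto
    then show "q \<in> comp_rel X Y (length ns) (sum_list ns) `` {(x, ns, ind_class Y ns ys \<sigma>)}"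
      using balanced.l_closed[OF comp_rel_balanced[OF assms(1,2)] t, of \<pi>] t assms(3)
      by (auto simp: comp_rel_def bal_rel_def is_rep_def)
  qed
qed

lemma is_rep_comp:
  "is_rep X Y x ns ys \<sigma> \<Longrightarrow> \<rho> \<in> Sym (sum_list ns) \<Longrightarrow> is_rep X Y x ns ys (\<sigma> \<circ> \<rho>)"
  "is_rep X Y x ns ys \<sigma> \<Longrightarrow> \<rho> \<in> Sym (sum_list ns) \<Longrightarrow> is_rep X Y x ns ys (\<rho> \<circ> \<sigma>)"
  by (auto simp: is_rep_def)

lemma comp_act:
  assumes X: "s_collection X" and Y: "s_collection Y" and rep: "is_rep X Y x ns ys \<sigma>" and rho: "\<rho>
      \<in> Sym (sum_list ns)"
  shows "act (X \<odot> Y) n (cmp_class X Y x ns ys \<sigma>) \<rho> = cmp_class X Y x ns ys (\<sigma> \<circ> \<rho>)"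
proof -
  let ?R = "\<lambda>(ys, \<sigma>). (ys, \<sigma> \<circ> \<rho>)"
  have R: "?R ` ind_class Y ms zs \<tau> = ind_class Y ms zs (\<tau> \<circ> \<rho>)"
    if "zs \<in> inputs Y ms" "\<tau> \<in> Sym (sum_list ms)" "\<rho> \<in> Sym (sum_list ms)" for ms zs \<tau>
  proof (intro equalityI subsetI)
    fix q assume "q \<in> ?R ` ind_class Y ms zs \<tau>"
    then obtain zs' \<tau>s where "q = (zs', block_sum ms \<tau>s \<circ> (\<tau> \<circ> \<rho>))" "zs' \<in> inputs Y ms" "\<tau>s \<in> Young ms"
      "zs = act_list Y ms zs' \<tau>s"
      by (auto simp: ind_rel_iff comp_assoc)
    then show "q \<in> ind_class Y ms zs (\<tau> \<circ> \<rho>)"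
      using that Sym_comp[OF block_sum_Sym Sym_comp[of \<tau> _ \<rho>]] by (simp add: ind_rel_iff Sym_comp) blast
  next
    fix q assume "q \<in> ind_class Y ms zs (\<tau> \<circ> \<rho>)"
    then obtain zs' \<tau>s where "q = ?R (zs', block_sum ms \<tau>s \<circ> \<tau>)" "zs' \<in> inputs Y ms" "\<tau>s \<in> Young ms"
      "zs = act_list Y ms zs' \<tau>s"
      by (cases q) (auto simp: ind_rel_iff comp_assoc)
    then show "q \<in> ?R ` ind_class Y ms zs \<tau>"
      using that by (intro image_eqI[of _ _ "(zs', block_sum ms \<tau>s \<circ> \<tau>)"]) (auto simp: ind_rel_iff)
  qed
  have "(\<lambda>(x, ns, c). (x, ns, ?R ` c)) ` comp_rel X Y (length ns) (sum_list ns) `` {(x, ns,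
      ind_class Y ns ys \<sigma>)}
    = comp_rel X Y (length ns) (sum_list ns) `` {(x, ns, ind_class Y ns ys (\<sigma> \<circ> \<rho>))}"
    unfolding comp_rel_class[OF X Y rep] comp_rel_class[OF X Y is_rep_comp(1)[OF rep rho]] image_image
  proof (rule image_cong[OF refl])
    fix q assume "q \<in> {(x', \<pi>). x' \<in> ops X (length ns) \<and> \<pi> \<in> Sym (length ns) \<and> x = act X (length
        ns) x' \<pi>}"
    then obtain x' \<pi> where q: "q = (x', \<pi>)" and pi: "\<pi> \<in> Sym (length ns)" by auto
    have "?R ` ind_class Y (move \<pi> ns) (move \<pi> ys) (block_perm \<pi> ns \<circ> \<sigma>)
        = ind_class Y (move \<pi> ns) (move \<pi> ys) ((block_perm \<pi> ns \<circ> \<sigma>) \<circ> \<rho>)"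
      by (rule R) (use rep rho pi in \<open>auto simp: is_rep_def inputs_move\<close>)
    then show "(case case q of (x', \<pi>) \<Rightarrow> (x', move \<pi> ns, ind_class Y (move \<pi> ns) (move \<pi> ys)
        (block_perm \<pi> ns \<circ> \<sigma>)) of
             (x, ns, c) \<Rightarrow> (x, ns, ?R ` c)) =
          (case q of (x', \<pi>) \<Rightarrow> (x', move \<pi> ns, ind_class Y (move \<pi> ns) (move \<pi> ys) (block_perm \<pi>
              ns \<circ> (\<sigma> \<circ> \<rho>))))"
      using q by (simp add: comp_assoc)
  qed
  then show ?thesis by (simp add: comp_prod_def cmp_class_def)
qed

lemma s_collection_comp:
  assumes X: "s_collection X" and Y: "s_collection Y"
  shows "s_collection (X \<odot> Y)"
  unfolding s_collection_def
proof (intro allI ballI conjI)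
  fix n z assume "z \<in> ops (X \<odot> Y) n"
  then obtain x ns ys \<sigma> where z: "is_rep X Y x ns ys \<sigma>" "sum_list ns = n" "z = cmp_class X Y x ns ys \<sigma>"
    by (rule comp_ops_exhaust)
  note ca = comp_act[OF X Y]
  show "act (X \<odot> Y) n z id = z" using z ca[OF z(1), of id] by simp
  fix \<rho> assume r: "\<rho> \<in> Sym n"
  show "act (X \<odot> Y) n z \<rho> \<in> ops (X \<odot> Y) n"
    using z r by (simp add: ca cmp_class_ops is_rep_comp)
  fix \<tau> assume t: "\<tau> \<in> Sym n"
  show "act (X \<odot> Y) n z (\<rho> \<circ> \<tau>) = act (X \<odot> Y) n (act (X \<odot> Y) n z \<rho>) \<tau>"
    using z r t by (simp add: ca is_rep_comp Sym_comp comp_assoc)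
qed

lemma is_rep_move:
  "is_rep X Y x ns ys \<sigma> \<Longrightarrow> \<pi> \<in> Sym (length ns) \<Longrightarrow> is_rep X Y x (move \<pi> ns) (move \<pi> ys) (block_perm \<pi>
      ns \<circ> \<sigma>)"
  by (auto simp: is_rep_def inputs_move)

lemma act_list_closed: "s_collection Y \<Longrightarrow> ys \<in> inputs Y ns \<Longrightarrow> \<tau>s \<in> Young ns \<Longrightarrow> act_list Y ns ys \<tau>s \<in>
    inputs Y ns"
  by (auto simp: in_listset act_closed)

section \<open>Functoriality and unitors on representatives\<close>

lemma is_rep_map:
  assumes "morphism X X' f" "morphism Y Y' g" "is_rep X Y x ns ys \<sigma>"
  shows "is_rep X' Y' (f (length ns) x) ns (map2 g ns ys) \<sigma>"
  using assms by (auto simp: is_rep_def morphism_def in_listset)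

lemma prod_mor_class:
  assumes "s_collection X" "s_collection Y" "s_collection X'" "s_collection Y'"
    and f: "morphism X X' f" and g: "morphism Y Y' g" and rep: "is_rep X Y x ns ys \<sigma>"
  shows "prod_mor X' Y' f g n (cmp_class X Y x ns ys \<sigma>) = cmp_class X' Y' (f (length ns) x) ns
      (map2 g ns ys) \<sigma>"
  unfolding prod_mor_def
proof (rule on_reps_cmp_class[OF assms(1,2) rep], goal_cases)
  case (1 x ns' ys \<sigma> \<pi>)
  have "length ys = length ns'" using 1 by (auto simp: is_rep_def in_listset)
  then show ?case
    using 1 f cmp_class_move[OF assms(3,4) is_rep_map[OF f g 1(1)], of \<pi>]
    by (simp add: map2_move morphism_def is_rep_def)
next
  case (2 x ns' ys \<sigma> \<tau>s)
  have "map2 g ns' (act_list Y ns' ys \<tau>s) = act_list Y' ns' (map2 g ns' ys) \<tau>s"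
    using 2 g by (auto simp: is_rep_def in_listset morphism_def intro!: nth_equalityI)
  then show ?case
    using 2 cmp_class_act_list[OF assms(4) is_rep_map[OF f g 2(1)], of \<tau>s] by simp
qed

lemma s_collection_unit: "s_collection \<I>"
  by (simp add: s_collection_def unit_coll_def)

lemma Sym_1: "\<sigma> \<in> Sym (Suc 0) \<longleftrightarrow> \<sigma> = id"
proof
  assume "\<sigma> \<in> Sym (Suc 0)"
  then have "\<sigma> p = p" for p using Sym_less[of \<sigma> 1 p] Sym_outside[of \<sigma> 1 p] by (cases p) simp_all
  then show "\<sigma> = id" by (simp add: fun_eq_iff)
qed simp

text \<open>Over the unit collection there is just one inner operation and no nontrivial
permutation of the factors; the second move is the action axiom of \<open>X\<close>.\<close>

lemma lunit_class:
  assumes X: "s_collection X" and rep: "is_rep \<I> X u ns xs \<sigma>" and n: "sum_list ns = n"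
  shows "lunit X n (cmp_class \<I> X u ns xs \<sigma>) = act X n (hd xs) \<sigma>"
  unfolding lunit_def
proof (rule on_reps_cmp_class[OF s_collection_unit X rep], goal_cases)
  case (1 x ns' ys \<sigma> \<pi>)
  then have "\<pi> = id" by (auto simp: is_rep_def unit_coll_def Sym_1 split: if_splits)
  then show ?case by simp
next
  case (2 x ns' ys \<sigma> \<tau>s)
  then have "length ns' = 1" by (auto simp: is_rep_def unit_coll_def split: if_splits)
  then have ns: "ns' = [n]" using 2 n by (cases ns') auto
  obtain y \<tau> where *: "ys = [y]" "\<tau>s = [\<tau>]" "y \<in> ops X n" "\<tau> \<in> Sym n"
    using 2 unfolding ns is_rep_def by (auto simp: set_Cons_def)
  have "block_sum [n] [\<tau>] = \<tau>"
    by (rule ext) (use Sym_outside[OF *(4)] in \<open>auto simp: block_sum_def\<close>)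
  moreover have "act_list X ns' ys \<tau>s = [act X n y \<tau>]"
    by (simp add: act_list_def ns *)
  ultimately show ?case using * 2 X ns by (simp add: act_comp is_rep_def)
qed

lemma block_sum_units:
  assumes "\<tau>s \<in> Young ns" "set ns \<subseteq> {1}" shows "block_sum ns \<tau>s = id"
proof -
  have "\<tau>s = map (\<lambda>_. id) ns"
  proof (rule nth_equalityI)
    fix i assume "i < length \<tau>s"
    then have "i < length ns" "\<tau>s ! i \<in> Sym (ns ! i)" using assms(1) by (auto simp: Young_iff)
    moreover from this have "ns ! i = Suc 0" using assms(2) nth_mem by fastforce
    ultimately show "\<tau>s ! i = map (\<lambda>_. id) ns ! i" by (simp add: Sym_1)
  qed (use assms in \<open>simp add: Young_iff\<close>)
  then show ?thesis by simp
qed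

lemma position_units: "set ns \<subseteq> {1} \<Longrightarrow> i \<le> length ns \<Longrightarrow> position ns i 0 = i"
  by (induction ns arbitrary: i) (auto simp: position_def take_Cons split: nat.split)

lemma block_perm_units:
  assumes "\<pi> \<in> Sym (length ns)" "set ns \<subseteq> {1}" shows "block_perm \<pi> ns = \<pi>"
proof (rule block_ext[of ns])
  fix i j assume ij: "i < length ns" "j < ns ! i"
  have "ns = replicate (length ns) 1" using assms(2) by (auto intro: replicate_eqI)
  then have nm: "move \<pi> ns = ns"
    using assms(1) by (intro list_eq_image[of \<pi> "length ns"]) (auto, metis Sym_less nth_replicate)
  have "ns ! i = 1" using assms ij by (meson nth_mem singletonD subsetD)
  then have "j = 0" using ij by simp
  then show "block_perm \<pi> ns (position ns i j) = \<pi> (position ns i j)"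
    using assms ij block_perm_position[of i ns j \<pi>]
    by (simp add: nm position_units[OF assms(2)] less_imp_le)
next
  fix p assume "\<not> p < sum_list ns"
  moreover have "sum_list ns = length ns" using assms(2) by (induction ns) auto
  ultimately show "block_perm \<pi> ns p = \<pi> p" using assms by (simp add: Sym_outside)
qed

lemma inputs_unit: "us \<in> inputs \<I> ns \<Longrightarrow> set ns \<subseteq> {1}"
  by (force simp: in_listset unit_coll_def set_conv_nth split: if_splits)

lemma sum_units: "set ns \<subseteq> {1::nat} \<Longrightarrow> sum_list ns = length ns"
  by (induction ns) auto

text \<open>All inner arities are \<open>1\<close>, so a block permutation is the permutation itself; the first move is
the action axiom of \<open>X\<close>.\<close>

lemma runit_class:
  assumes X: "s_collection X" and rep: "is_rep X \<I> x ns us \<sigma>" and n: "sum_list ns = n"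
  shows "runit X n (cmp_class X \<I> x ns us \<sigma>) = act X n x \<sigma>"
  unfolding runit_def
proof (rule on_reps_cmp_class[OF X s_collection_unit rep], goal_cases)
  case (1 x ns' ys \<sigma> \<pi>)
  have u: "set ns' \<subseteq> {1}" using 1 inputs_unit by (auto simp: is_rep_def)
  then show ?case
    using 1 n X sum_units[OF u] by (simp add: block_perm_units is_rep_def act_comp)
next
  case (2 x ns' ys \<sigma> \<tau>s)
  have u: "set ns' \<subseteq> {1}" using 2 inputs_unit by (auto simp: is_rep_def)
  then show ?case using 2 by (simp add: block_sum_units)
qed

section \<open>The powerset functors and their structure maps\<close>

text \<open>The two functors differ only in whether the empty set is admitted, which is what the flag \<open>e\<close> records.\<close>

definition pw :: "bool \<Rightarrow> 'a scoll \<Rightarrow> 'a set scoll" where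
  "pw e X = \<lparr>ops = (\<lambda>n. {A. A \<subseteq> ops X n \<and> (A = {} \<longrightarrow> e)}), act = (\<lambda>n A \<sigma>. (\<lambda>x. act X n x \<sigma>) ` A)\<rparr>"

lemma pow_coll_pw: "\<P> X = pw True X"
  by (auto simp: pow_coll_def pw_def Pow_def)

lemma npow_coll_pw: "\<P>\<^sub>+ X = pw False X"
  by (auto simp: npow_coll_def pw_def)

lemma pw_ops: "A \<in> ops (pw e X) n \<longleftrightarrow> A \<subseteq> ops X n \<and> (A = {} \<longrightarrow> e)"
  by (simp add: pw_def)

lemma pw_act: "act (pw e X) n A \<sigma> = (\<lambda>x. act X n x \<sigma>) ` A"
  by (simp add: pw_def)

lemma s_collection_pw:
  assumes X: "s_collection X" shows "s_collection (pw e X)"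
  unfolding s_collection_def
proof (intro allI ballI conjI)
  fix n A assume "A \<in> ops (pw e X) n"
  then have A: "\<And>x. x \<in> A \<Longrightarrow> x \<in> ops X n" "A = {} \<Longrightarrow> e" by (auto simp: pw_ops)
  show "act (pw e X) n A id = A" using A X by (simp add: pw_act act_id)
  fix \<sigma> assume "\<sigma> \<in> Sym n"
  then show "act (pw e X) n A \<sigma> \<in> ops (pw e X) n"
    using A X by (auto simp: pw_act pw_ops act_closed)
  fix \<tau> assume "\<tau> \<in> Sym n"
  then show "act (pw e X) n A (\<sigma> \<circ> \<tau>) = act (pw e X) n (act (pw e X) n A \<sigma>) \<tau>"
    using A X \<open>\<sigma> \<in> Sym n\<close> by (simp add: pw_act image_image act_comp)
qed

lemma morphism_img:
  assumes f: "morphism X X' f" shows "morphism (pw e X) (pw e X') (img f)"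
  unfolding morphism_def
proof (intro allI ballI conjI)
  fix n A assume "A \<in> ops (pw e X) n"
  then have A: "\<And>x. x \<in> A \<Longrightarrow> x \<in> ops X n" "A = {} \<Longrightarrow> e" by (auto simp: pw_ops)
  show "img f n A \<in> ops (pw e X') n" using A f by (auto simp: img_def pw_ops morphism_def)
  fix \<sigma> assume "\<sigma> \<in> Sym n"
  then show "img f n (act (pw e X) n A \<sigma>) = act (pw e X') n (img f n A) \<sigma>"
    using A f by (simp add: img_def pw_act image_image morphism_def)
qed

lemma img_id: "mor_eq (pw e X) (img mor_id) mor_id"
  by (simp add: mor_eq_def img_def mor_id_def)

lemma img_comp: "mor_eq (pw e X) (img (f' \<cdot> f)) (img f' \<cdot> img f)"
  by (auto simp: mor_eq_def img_def mor_comp_def)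

lemma pw_rep_choose:
  assumes "is_rep (pw e X) (pw e Y) A ns Bs \<sigma>" "a \<in> A" "bs \<in> listset Bs"
  shows "is_rep X Y a ns bs \<sigma>"
  using assms by (fastforce simp: is_rep_def in_listset pw_ops)

text \<open>By this the second move passes from lists of subsets to the lists chosen from them.\<close>

lemma listset_act_list:
  assumes "length Bs = length ns"
  shows "listset (act_list (pw e Y) ns Bs \<tau>s) = (\<lambda>bs. act_list Y ns bs \<tau>s) ` listset Bs"
proof (intro equalityI subsetI)
  fix cs assume cs: "cs \<in> listset (act_list (pw e Y) ns Bs \<tau>s)"
  then have "\<forall>i<length ns. \<exists>b. b \<in> Bs ! i \<and> cs ! i = act Y (ns ! i) b (\<tau>s ! i)"
    by (auto simp: in_listset pw_act)
  then obtain b where b: "\<And>i. i < length ns \<Longrightarrow> b i \<in> Bs ! i \<and> cs ! i = act Y (ns ! i) (b i) (\<tau>s ! i)"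
    by metis
  then have "cs = act_list Y ns (map b [0..<length ns]) \<tau>s"
    using cs by (auto simp: in_listset intro!: nth_equalityI)
  moreover have "map b [0..<length ns] \<in> listset Bs" using b assms by (simp add: in_listset)
  ultimately show "cs \<in> (\<lambda>bs. act_list Y ns bs \<tau>s) ` listset Bs" by blast
qed (use assms in \<open>auto simp: in_listset pw_act\<close>)

text \<open>Both moves on lists of subsets are the same moves on all the chosen elements at once, so they do
not change the set of classes of choices.\<close>

lemma pow_mult_class:
  assumes X: "s_collection X" and Y: "s_collection Y" and rep: "is_rep (pw e X) (pw e Y) A ns Bs \<sigma>"
  shows "pow_mult X Y n (cmp_class (pw e X) (pw e Y) A ns Bs \<sigma>)
    = {cmp_class X Y a ns bs \<sigma> | a bs. a \<in> A \<and> bs \<in> listset Bs}"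
  unfolding pow_mult_def
proof (rule on_reps_cmp_class[OF s_collection_pw[OF X] s_collection_pw[OF Y] rep], goal_cases)
  case (1 A ns' Bs \<sigma> \<pi>)
  have "cmp_class X Y (act X (length ns) a \<pi>) ns' bs \<sigma>
      = cmp_class X Y a (move \<pi> ns') (move \<pi> bs) (block_perm \<pi> ns' \<circ> \<sigma>)" if "a \<in> A" "bs \<in> listset
          Bs" for a bs
    using cmp_class_move[OF X Y pw_rep_choose[OF 1(1) that]] 1 by simp
  moreover have "length Bs = length ns'" using 1 by (simp add: is_rep_def in_listset)
  ultimately show ?case using 1 by (force simp: pw_act listset_move)
next
  case (2 A ns' Bs \<sigma> \<tau>s)
  have "cmp_class X Y a ns' (act_list Y ns' bs \<tau>s) \<sigma> = cmp_class X Y a ns' bs (block_sum ns' \<tau>s \<circ> \<sigma>)"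
    if "a \<in> A" "bs \<in> listset Bs" for a bs
    using cmp_class_act_list[OF Y pw_rep_choose[OF 2(1) that]] 2 by simp
  moreover have "length Bs = length ns'" using 2 by (simp add: is_rep_def in_listset)
  ultimately show ?case by (force simp: listset_act_list)
qed

lemma listset_empty: "listset Bs = {} \<longleftrightarrow> {} \<in> set Bs"
  by (induction Bs) (auto simp: set_Cons_def)

lemma morphism_pow_mult:
  assumes X: "s_collection X" and Y: "s_collection Y"
  shows "morphism (pw e X \<odot> pw e Y) (pw e (X \<odot> Y)) (pow_mult X Y)"
  unfolding morphism_def
proof (intro allI ballI conjI)
  fix n z assume "z \<in> ops (pw e X \<odot> pw e Y) n"
  then obtain A ns Bs \<sigma> where z: "is_rep (pw e X) (pw e Y) A ns Bs \<sigma>" "sum_list ns = n"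
    "z = cmp_class (pw e X) (pw e Y) A ns Bs \<sigma>" by (rule comp_ops_exhaust)
  \<comment> \<open>There is no choice only if one of the sets is empty, so nonempty subsets yield a nonempty set.\<close>
  have e: "A = {} \<or> listset Bs = {} \<longrightarrow> e"
    using z(1) by (auto simp: is_rep_def pw_ops listset_empty in_listset in_set_conv_nth)
  then have "{cmp_class X Y a ns bs \<sigma> | a bs. a \<in> A \<and> bs \<in> listset Bs} = {} \<longrightarrow> e" by blast
  then show "pow_mult X Y n z \<in> ops (pw e (X \<odot> Y)) n"
    unfolding z(3) pow_mult_class[OF X Y z(1)]
    using cmp_class_ops[OF pw_rep_choose[OF z(1)] z(2)] by (auto simp: pw_ops)
  fix \<rho> assume r: "\<rho> \<in> Sym n"
  have "act (X \<odot> Y) n (cmp_class X Y a ns bs \<sigma>) \<rho> = cmp_class X Y a ns bs (\<sigma> \<circ> \<rho>)"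
    if "a \<in> A" "bs \<in> listset Bs" for a bs
    using comp_act[OF X Y pw_rep_choose[OF z(1) that]] r z(2) by simp
  moreover have "pow_mult X Y n (act (pw e X \<odot> pw e Y) n z \<rho>) = {cmp_class X Y a ns bs (\<sigma> \<circ> \<rho>) | a
      bs. a \<in> A \<and> bs \<in> listset Bs}"
    using z r pow_mult_class[OF X Y is_rep_comp(1)[OF z(1)], of \<rho>]
    by (simp add: comp_act[OF s_collection_pw[OF X] s_collection_pw[OF Y] z(1)])
  ultimately show "pow_mult X Y n (act (pw e X \<odot> pw e Y) n z \<rho>) = act (pw e (X \<odot> Y)) n (pow_mult X
      Y n z) \<rho>"
    unfolding z(3) pow_mult_class[OF X Y z(1)] pw_act by force
qed

lemma morphism_pow_unit: "morphism \<I> (pw e \<I>) pow_unit"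
  by (auto simp: morphism_def pow_unit_def pw_ops pw_act unit_coll_def)

text \<open>The choices on the two sides of the naturality square are compared by this.\<close>

lemma listset_map2_img:
  assumes "length Bs = length ns"
  shows "listset (map2 (img g) ns Bs) = map2 g ns ` listset Bs"
proof (intro equalityI subsetI)
  fix cs assume cs: "cs \<in> listset (map2 (img g) ns Bs)"
  then have "\<forall>i<length ns. \<exists>b. b \<in> Bs ! i \<and> cs ! i = g (ns ! i) b"
    using assms by (auto simp: in_listset img_def)
  then obtain b where b: "\<And>i. i < length ns \<Longrightarrow> b i \<in> Bs ! i \<and> cs ! i = g (ns ! i) (b i)"
    by metis
  then have "cs = map2 g ns (map b [0..<length ns])"
    using cs assms by (auto simp: in_listset intro!: nth_equalityI)
  moreover have "map b [0..<length ns] \<in> listset Bs" using b assms by (simp add: in_listset)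
  ultimately show "cs \<in> map2 g ns ` listset Bs" by blast
qed (use assms in \<open>auto simp: in_listset img_def\<close>)

lemma pow_mult_natural:
  assumes X: "s_collection X" and Y: "s_collection Y" and X': "s_collection X'" and Y': "s_collection Y'"
    and f: "morphism X X' f" and g: "morphism Y Y' g"
  shows "mor_eq (pw e X \<odot> pw e Y) (img (prod_mor X' Y' f g) \<cdot> pow_mult X Y)
     (pow_mult X' Y' \<cdot> prod_mor (pw e X') (pw e Y') (img f) (img g))"
  unfolding mor_eq_def
proof (intro allI ballI)
  fix n z assume "z \<in> ops (pw e X \<odot> pw e Y) n"
  then obtain A ns Bs \<sigma> where z: "is_rep (pw e X) (pw e Y) A ns Bs \<sigma>" "sum_list ns = n"
    "z = cmp_class (pw e X) (pw e Y) A ns Bs \<sigma>" by (rule comp_ops_exhaust)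
  have "prod_mor X' Y' f g n (cmp_class X Y a ns bs \<sigma>) = cmp_class X' Y' (f (length ns) a) ns
      (map2 g ns bs) \<sigma>"
    if "a \<in> A" "bs \<in> listset Bs" for a bs
    by (rule prod_mor_class[OF X Y X' Y' f g pw_rep_choose[OF z(1) that]])
  then have "(img (prod_mor X' Y' f g) \<cdot> pow_mult X Y) n z
    = {cmp_class X' Y' (f (length ns) a) ns (map2 g ns bs) \<sigma> | a bs. a \<in> A \<and> bs \<in> listset Bs}"
    unfolding mor_comp_def z(3) pow_mult_class[OF X Y z(1)] img_def by force
  moreover have "(pow_mult X' Y' \<cdot> prod_mor (pw e X') (pw e Y') (img f) (img g)) n z
    = {cmp_class X' Y' a ns bs \<sigma> | a bs. a \<in> f (length ns) ` A \<and> bs \<in> map2 g ns ` listset Bs}"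
    unfolding mor_comp_def z(3)
      prod_mor_class[OF s_collection_pw[OF X] s_collection_pw[OF Y] s_collection_pw[OF X']
          s_collection_pw[OF Y']
        morphism_img[OF f] morphism_img[OF g] z(1)]
      pow_mult_class[OF X' Y' is_rep_map[OF morphism_img[OF f] morphism_img[OF g] z(1)]]
    using z(1) by (simp add: listset_map2_img is_rep_def in_listset) (simp add: img_def)
  ultimately show "(img (prod_mor X' Y' f g) \<cdot> pow_mult X Y) n z
      = (pow_mult X' Y' \<cdot> prod_mor (pw e X') (pw e Y') (img f) (img g)) n z" by auto
qed

lemma morphism_id: "morphism X X mor_id"
  by (simp add: morphism_def mor_id_def)

lemma map2_mor_id [simp]: "length xs = length ns \<Longrightarrow> map2 mor_id ns xs = xs"
  by (rule nth_equalityI) (auto simp: mor_id_def)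

lemma length_inputs: "is_rep X Y x ns ys \<sigma> \<Longrightarrow> length ys = length ns"
  by (simp add: is_rep_def in_listset)

lemma pow_lunit:
  assumes X: "s_collection X"
  shows "mor_eq (\<I> \<odot> pw e X) (img (lunit X) \<cdot> pow_mult \<I> X \<cdot> prod_mor (pw e \<I>) (pw e X) pow_unit mor_id)
        (lunit (pw e X))"
  unfolding mor_eq_def
proof (intro allI ballI)
  note I = s_collection_unit and PX = s_collection_pw[OF X]
  fix n z assume "z \<in> ops (\<I> \<odot> pw e X) n"
  then obtain u ns Bs \<sigma> where z: "is_rep \<I> (pw e X) u ns Bs \<sigma>" "sum_list ns = n"
    "z = cmp_class \<I> (pw e X) u ns Bs \<sigma>" by (rule comp_ops_exhaust)
  note [simp] = length_inputs[OF z(1)]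
  have rep: "is_rep (pw e \<I>) (pw e X) (pow_unit (length ns) u) ns Bs \<sigma>"
    using is_rep_map[OF morphism_pow_unit morphism_id z(1)] by simp
  have len: "length Bs = 1" using z(1) by (auto simp: is_rep_def unit_coll_def split: if_splits)
  then obtain B where B: "Bs = [B]" by (cases Bs) auto
  have "lunit X n (cmp_class \<I> X u ns bs \<sigma>) = act X n (hd bs) \<sigma>" if "bs \<in> listset Bs" for bs
    by (rule lunit_class[OF X pw_rep_choose[OF rep _ that] z(2)]) (simp add: pow_unit_def)
  then have "img (lunit X) n (pow_mult \<I> X n (cmp_class (pw e \<I>) (pw e X) (pow_unit (length ns) u)
      ns Bs \<sigma>))
     = (\<lambda>bs. act X n (hd bs) \<sigma>) ` listset Bs"
    unfolding pow_mult_class[OF I X rep] unfolding img_def pow_unit_def by force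
  also have "\<dots> = act (pw e X) n (hd Bs) \<sigma>" by (force simp: B pw_act set_Cons_def)
  finally show "(img (lunit X) \<cdot> pow_mult \<I> X \<cdot> prod_mor (pw e \<I>) (pw e X) pow_unit mor_id) n z =
      lunit (pw e X) n z"
    unfolding mor_comp_def z(3) prod_mor_class[OF I PX s_collection_pw[OF I] PX morphism_pow_unit
        morphism_id z(1)]
      lunit_class[OF PX z(1,2)] by simp
qed

lemma pow_runit:
  assumes X: "s_collection X"
  shows "mor_eq (pw e X \<odot> \<I>) (img (runit X) \<cdot> pow_mult X \<I> \<cdot> prod_mor (pw e X) (pw e \<I>) mor_id pow_unit)
        (runit (pw e X))"
  unfolding mor_eq_def
proof (intro allI ballI)
  note I = s_collection_unit and PX = s_collection_pw[OF X]
  fix n z assume "z \<in> ops (pw e X \<odot> \<I>) n"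
  then obtain A ns us \<sigma> where z: "is_rep (pw e X) \<I> A ns us \<sigma>" "sum_list ns = n"
    "z = cmp_class (pw e X) \<I> A ns us \<sigma>" by (rule comp_ops_exhaust)
  note [simp] = length_inputs[OF z(1)]
  have rep: "is_rep (pw e X) (pw e \<I>) A ns (map2 pow_unit ns us) \<sigma>"
    using is_rep_map[OF morphism_id morphism_pow_unit z(1)] by (simp add: mor_id_def)
  have us: "us \<in> listset (map2 pow_unit ns us)" by (simp add: in_listset pow_unit_def)
  have "bs = us" if "bs \<in> listset (map2 pow_unit ns us)" for bs
    using that by (auto simp: in_listset pow_unit_def intro: nth_equalityI)
  moreover have "runit X n (cmp_class X \<I> a ns us \<sigma>) = act X n a \<sigma>" if "a \<in> A" for a
    by (rule runit_class[OF X pw_rep_choose[OF rep that us] z(2)])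
  ultimately have "img (runit X) n (pow_mult X \<I> n (cmp_class (pw e X) (pw e \<I>) A ns (map2
      pow_unit ns us) \<sigma>))
     = act (pw e X) n A \<sigma>"
    unfolding pow_mult_class[OF X I rep] img_def pw_act using us by force
  then show "(img (runit X) \<cdot> pow_mult X \<I> \<cdot> prod_mor (pw e X) (pw e \<I>) mor_id pow_unit) n z =
      runit (pw e X) n z"
    unfolding mor_comp_def z(3) prod_mor_class[OF PX I PX s_collection_pw[OF I] morphism_id
        morphism_pow_unit z(1)]
      runit_class[OF PX z(1,2)] by (simp add: mor_id_def)
qed

section \<open>The associator on representatives\<close>

definition grafts :: "'b scoll \<Rightarrow> 'c scoll \<Rightarrow> 'b list \<Rightarrow> nat list list \<Rightarrow> 'c list list \<Rightarrow> ('b, 'c) cmp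
    list" where
  "grafts Y Z ys mss zss = map (\<lambda>i. cmp_class Y Z (ys ! i) (mss ! i) (zss ! i) id) [0..<length mss]"

text \<open>The composite \<open>[x; [y\<^sub>0; zs\<^sub>0], [y\<^sub>1; zs\<^sub>1], \<dots>] \<cdot> \<rho>\<close>, the shape of the values of the associator.
The list \<open>mss\<close> of arities of the innermost operations also determines the arities of the \<open>ys\<close>, as the
lengths of its members.\<close>

definition graft where
  "graft X Y Z x ys mss zss \<rho> = cmp_class X (Y \<odot> Z) x (map sum_list mss) (grafts Y Z ys mss zss) \<rho>"

definition graftable where
  "graftable X Y Z x ys mss zss \<rho> \<longleftrightarrow> x \<in> ops X (length mss) \<and> ys \<in> inputs Y (map length mss) \<and>
     zss \<in> listset (map (inputs Z) mss) \<and> \<rho> \<in> Sym (sum_list (concat mss))"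

lemma length_grafts [simp]: "length (grafts Y Z ys mss zss) = length mss"
  by (simp add: grafts_def)

lemma grafts_nth [simp]: "i < length mss \<Longrightarrow> grafts Y Z ys mss zss ! i = cmp_class Y Z (ys ! i) (mss
    ! i) (zss ! i) id"
  by (simp add: grafts_def)

lemma graftable_nth:
  assumes "graftable X Y Z x ys mss zss \<rho>" "i < length mss"
  shows "is_rep Y Z (ys ! i) (mss ! i) (zss ! i) id"
  using assms by (auto simp: graftable_def is_rep_def in_listset)

lemma graftable_rep:
  assumes "graftable X Y Z x ys mss zss \<rho>"
  shows "is_rep X (Y \<odot> Z) x (map sum_list mss) (grafts Y Z ys mss zss) \<rho>"
proof -
  have "grafts Y Z ys mss zss \<in> inputs (Y \<odot> Z) (map sum_list mss)"
    by (auto simp: in_listset intro!: cmp_class_ops graftable_nth[OF assms])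
  then show ?thesis using assms by (simp add: graftable_def is_rep_def sum_concat)
qed

lemma graft_move:
  assumes "s_collection X" "s_collection Y" "s_collection Z"
    and g: "graftable X Y Z x ys mss zss \<rho>" and pi: "\<pi> \<in> Sym (length mss)"
  shows "graft X Y Z (act X (length mss) x \<pi>) ys mss zss \<rho>
    = graft X Y Z x (move \<pi> ys) (move \<pi> mss) (move \<pi> zss) (block_perm \<pi> (map sum_list mss) \<circ> \<rho>)"
proof -
  have "move \<pi> (grafts Y Z ys mss zss) = grafts Y Z (move \<pi> ys) (move \<pi> mss) (move \<pi> zss)"
    by (rule list_eq_image[OF pi]) (use g pi in \<open>simp_all add: graftable_def in_listset\<close>)
  then show ?thesis
    using cmp_class_move[OF assms(1) s_collection_comp[OF assms(2,3)] graftable_rep[OF g], of \<pi>] pi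
    by (simp add: graft_def map_move)
qed

text \<open>Permutations of the inputs of the composites \<open>[y\<^sub>i; zs\<^sub>i]\<close> may be collected at the outside;
the innermost and the middle operations are both moved by means of this.\<close>

lemma graft_act_list:
  assumes "s_collection Y" "s_collection Z"
    and g: "graftable X Y Z x ys mss zss \<rho>" and rs: "\<rho>s \<in> Young (map sum_list mss)"
    and eq: "\<And>i. i < length mss \<Longrightarrow> d ! i = cmp_class Y Z (ys ! i) (mss ! i) (zss ! i) (\<rho>s ! i)"
    and "length d = length mss"
  shows "cmp_class X (Y \<odot> Z) x (map sum_list mss) d \<rho> = graft X Y Z x ys mss zss (block_sum (map
      sum_list mss) \<rho>s \<circ> \<rho>)"
proof -
  have "d = act_list (Y \<odot> Z) (map sum_list mss) (grafts Y Z ys mss zss) \<rho>s"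
    using assms comp_act[OF assms(1,2) graftable_nth[OF g]]
    by (intro nth_equalityI) (auto simp: in_listset)
  then show ?thesis
    using cmp_class_act_list[OF s_collection_comp[OF assms(1,2)] graftable_rep[OF g] rs]
    by (simp add: graft_def)
qed

text \<open>Inside \<open>[y\<^sub>i \<cdot> \<tau>\<^sub>i; zs\<^sub>i]\<close> the first move turns \<open>\<tau>\<^sub>i\<close> into a permutation of \<open>zs\<^sub>i\<close>
and a block permutation, which then passes to the outside by the second move.\<close>

lemma graft_act_middle:
  assumes "s_collection Y" "s_collection Z"
    and g: "graftable X Y Z x ys mss zss \<rho>" and ts: "\<tau>s \<in> Young (map length mss)"
  shows "graft X Y Z x (act_list Y (map length mss) ys \<tau>s) mss zss \<rho>
    = graft X Y Z x ys (map2 move \<tau>s mss) (map2 move \<tau>s zss)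
        (block_sum (map sum_list mss) (map2 block_perm \<tau>s mss) \<circ> \<rho>)"
proof -
  have len [simp]: "length \<tau>s = length mss" "length zss = length mss"
    using ts g by (auto simp: in_listset graftable_def)
  have ti: "\<tau>s ! i \<in> Sym (length (mss ! i))" if "i < length mss" for i
    using ts that by (auto simp: in_listset)
  have sl: "map sum_list (map2 move \<tau>s mss) = map sum_list mss"
    using ti by (auto intro!: nth_equalityI)
  have g': "graftable X Y Z x ys (map2 move \<tau>s mss) (map2 move \<tau>s zss) \<rho>"
    using g ti unfolding graftable_def sum_concat sl
    by (auto simp: in_listset[of _ "map f xs" for f xs] inputs_move)
  have "graft X Y Z x (act_list Y (map length mss) ys \<tau>s) mss zss \<rho>
     = cmp_class X (Y \<odot> Z) x (map sum_list (map2 move \<tau>s mss)) (grafts Y Z (act_list Y (map length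
         mss) ys \<tau>s) mss zss) \<rho>"
    unfolding graft_def sl ..
  also have "\<dots> = graft X Y Z x ys (map2 move \<tau>s mss) (map2 move \<tau>s zss)
     (block_sum (map sum_list (map2 move \<tau>s mss)) (map2 block_perm \<tau>s mss) \<circ> \<rho>)"
  proof (rule graft_act_list[OF assms(1,2) g'])
    show "map2 block_perm \<tau>s mss \<in> Young (map sum_list (map2 move \<tau>s mss))"
      unfolding sl using ti by (auto simp: in_listset)
    fix i assume "i < length (map2 move \<tau>s mss)"
    then have i: "i < length mss" by simp
    show "grafts Y Z (act_list Y (map length mss) ys \<tau>s) mss zss ! i =
         cmp_class Y Z (ys ! i) (map2 move \<tau>s mss ! i) (map2 move \<tau>s zss ! i) (map2 block_perm \<tau>s
             mss ! i)"
      using i cmp_class_move[OF assms(1,2) graftable_nth[OF g i] ti[OF i]] by simp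
  qed simp
  finally show ?thesis unfolding sl .
qed

text \<open>Two applications of the second move, first inside the composites \<open>[y\<^sub>i; zs\<^sub>i]\<close> and then
outside.\<close>

lemma graft_act_inner:
  assumes "s_collection Y" "s_collection Z"
    and g: "graftable X Y Z x ys mss zss \<rho>"
    and ts: "length \<tau>ss = length mss" "\<And>i. i < length mss \<Longrightarrow> \<tau>ss ! i \<in> Young (mss ! i)"
    and ds: "length dss = length mss" "\<And>i. i < length mss \<Longrightarrow> dss ! i = act_list Z (mss ! i) (zss !
        i) (\<tau>ss ! i)"
  shows "graft X Y Z x ys mss dss \<rho>
    = graft X Y Z x ys mss zss (block_sum (concat mss) (concat \<tau>ss) \<circ> \<rho>)"
proof -
  have bs: "block_sum (concat mss) (concat \<tau>ss) = block_sum (map sum_list mss) (map2 block_sum mss \<tau>ss)"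
    using block_sum_nested ts by blast
  show ?thesis
    unfolding bs graft_def[of _ _ _ _ _ _ dss]
  proof (rule graft_act_list[OF assms(1,2) g])
    show "map2 block_sum mss \<tau>ss \<in> Young (map sum_list mss)"
      using ts by (auto simp: in_listset[of _ "map f xs" for f xs])
    fix i assume i: "i < length mss"
    show "grafts Y Z ys mss dss ! i = cmp_class Y Z (ys ! i) (mss ! i) (zss ! i) (map2 block_sum
        mss \<tau>ss ! i)"
      using i ts ds cmp_class_act_list[OF assms(2) graftable_nth[OF g i] ts(2)[OF i]] by simp
  qed simp
qed

lemma chunks_eqI: "concat xss = xs \<Longrightarrow> map length xss = ns \<Longrightarrow> chunks ns xs = xss"
  using chunks_concat by blast

lemma length_chunks [simp]: "length (chunks ns xs) = length ns"
  by (induction ns arbitrary: xs) auto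

lemma listset_append: "length xs = length As \<Longrightarrow> xs @ ys \<in> listset (As @ Bs) \<longleftrightarrow> xs \<in> listset As \<and> ys
    \<in> listset Bs"
  by (induction xs As rule: list_induct2) (auto simp: set_Cons_def)

lemma listset_concat:
  assumes "map length xss = map length Ass"
  shows "concat xss \<in> listset (concat Ass) \<longleftrightarrow> xss \<in> listset (map listset Ass)"
proof -
  have "length xss = length Ass" using assms by (metis length_map)
  then show ?thesis using assms
    by (induction xss Ass rule: list_induct2) (auto simp: listset_append set_Cons_def)
qed

lemma chunks_listset:
  assumes "xs \<in> listset As" "length As = sum_list ns"
  shows "chunks ns xs \<in> listset (map listset (chunks ns As))"
  using assms concat_chunks[of xs ns] concat_chunks[of As ns] listset_concat[of "chunks ns xs"
      "chunks ns As"]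
  by (simp add: in_listset[of xs])

lemma chunks_map: "chunks ns (map f xs) = map (map f) (chunks ns xs)"
  by (induction ns arbitrary: xs) (auto simp: take_map drop_map)

text \<open>The value that the associator takes on the representative \<open>[[x; ys \<cdot> \<sigma>]; zs \<cdot> \<tau>]\<close>, as a
function of all its parts, so that its behaviour under each move can be stated.\<close>

definition reassociated where
  "reassociated X Y Z x ns ys \<sigma> ms zs \<tau> =
     graft X Y Z x ys (chunks ns (move \<sigma> ms)) (chunks ns (move \<sigma> zs)) (block_perm \<sigma> ms \<circ> \<tau>)"

definition nested_rep where
  "nested_rep X Y Z x ns ys \<sigma> ms zs \<tau> \<longleftrightarrow>
     is_rep X Y x ns ys \<sigma> \<and> length ms = sum_list ns \<and> zs \<in> inputs Z ms \<and> \<tau> \<in> Sym (sum_list ms)"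

lemma nested_rep_chunks:
  assumes "nested_rep X Y Z x ns ys \<sigma> ms zs \<tau>"
  shows "concat (chunks ns (move \<sigma> ms)) = move \<sigma> ms" "map length (chunks ns (move \<sigma> ms)) = ns"
    "concat (chunks ns (move \<sigma> zs)) = move \<sigma> zs" "map length (chunks ns (move \<sigma> zs)) = ns"
  using assms concat_chunks[of "move \<sigma> ms" ns] concat_chunks[of "move \<sigma> zs" ns]
  by (auto simp: nested_rep_def in_listset)

lemma nested_rep_graftable:
  assumes "nested_rep X Y Z x ns ys \<sigma> ms zs \<tau>"
  shows "graftable X Y Z x ys (chunks ns (move \<sigma> ms)) (chunks ns (move \<sigma> zs)) (block_perm \<sigma> ms \<circ> \<tau>)"
proof -
  note a = assms[unfolded nested_rep_def is_rep_def] and c = nested_rep_chunks[OF assms]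
  have "move \<sigma> zs \<in> inputs Z (move \<sigma> ms)" using a by (simp add: inputs_move)
  from chunks_listset[OF this, of ns] a
  have "chunks ns (move \<sigma> zs) \<in> listset (map (inputs Z) (chunks ns (move \<sigma> ms)))"
    by (simp add: chunks_map comp_def)
  then show ?thesis using a c(2) by (auto simp: graftable_def c(1) Sym_comp block_perm_Sym)
qed

text \<open>A permutation of the \<open>ys\<close> carries the inputs along in blocks, so that the chunks stay intact and
are permuted by \<open>\<pi>\<close>; what remains is the first move on the value.\<close>

lemma reassociated_move:
  assumes X: "s_collection X" "s_collection Y" "s_collection Z" and r: "nested_rep X Y Z x ns ys \<sigma>
      ms zs \<tau>"
    and pi: "\<pi> \<in> Sym (length ns)"
  shows "reassociated X Y Z (act X (length ns) x \<pi>) ns ys \<sigma> ms zs \<tau>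
    = reassociated X Y Z x (move \<pi> ns) (move \<pi> ys) (block_perm \<pi> ns \<circ> \<sigma>) ms zs \<tau>"
proof -
  note c = nested_rep_chunks[OF r]
  define mss zss where "mss = chunks ns (move \<sigma> ms)" and "zss = chunks ns (move \<sigma> zs)"
  have len: "length ms = sum_list ns" "length zs = sum_list ns" "\<sigma> \<in> Sym (sum_list ns)"
    using r by (auto simp: nested_rep_def is_rep_def in_listset)
  have bp: "block_perm \<pi> ns \<in> Sym (sum_list ns)" using pi by blast
  have pi': "\<pi> \<in> Sym (length mss)" "\<pi> \<in> Sym (length zss)" using pi by (simp_all add: mss_def zss_def)
  have 1: "chunks (move \<pi> ns) (move (block_perm \<pi> ns \<circ> \<sigma>) ms) = move \<pi> mss"
    using c len bp pi' by (intro chunks_eqI) (simp_all add: concat_move map_move move_comp mss_def)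
  have 2: "chunks (move \<pi> ns) (move (block_perm \<pi> ns \<circ> \<sigma>) zs) = move \<pi> zss"
    using c len bp pi' by (intro chunks_eqI) (simp_all add: concat_move map_move move_comp zss_def)
  have "block_perm (block_perm \<pi> ns \<circ> \<sigma>) ms \<circ> \<tau>
      = block_perm (block_perm \<pi> ns) (move \<sigma> ms) \<circ> (block_perm \<sigma> ms \<circ> \<tau>)"
    using len bp by (simp add: block_perm_comp comp_assoc)
  also have "block_perm (block_perm \<pi> ns) (move \<sigma> ms) = block_perm \<pi> (map sum_list mss)"
    using block_perm_block_perm[OF pi'(1)] c by (simp add: mss_def)
  finally have 3: "block_perm (block_perm \<pi> ns \<circ> \<sigma>) ms \<circ> \<tau>
      = block_perm \<pi> (map sum_list mss) \<circ> (block_perm \<sigma> ms \<circ> \<tau>)" .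
  have lm: "length mss = length ns" by (simp add: mss_def)
  show ?thesis
    unfolding reassociated_def 1 2 3 mss_def[symmetric] zss_def[symmetric]
    by (rule graft_move[OF X nested_rep_graftable[OF r], folded mss_def zss_def, of \<pi>, unfolded
        lm, OF pi])
qed

text \<open>A permutation of the inputs of \<open>y\<^sub>i\<close> keeps the chunks apart and only reorders the
members of each; the result differs from the original one as in \<open>graft_act_middle\<close>.\<close>

lemma reassociated_act_middle:
  assumes Y: "s_collection Y" "s_collection Z" and r: "nested_rep X Y Z x ns ys \<sigma> ms zs \<tau>"
    and ts: "\<tau>s \<in> Young ns"
  shows "reassociated X Y Z x ns (act_list Y ns ys \<tau>s) \<sigma> ms zs \<tau>
    = reassociated X Y Z x ns ys (block_sum ns \<tau>s \<circ> \<sigma>) ms zs \<tau>"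
proof -
  note c = nested_rep_chunks[OF r]
  define mss zss where "mss = chunks ns (move \<sigma> ms)" and "zss = chunks ns (move \<sigma> zs)"
  have len: "length ms = sum_list ns" "length zs = sum_list ns" "\<sigma> \<in> Sym (sum_list ns)" "length \<tau>s
      = length ns"
    using r ts by (auto simp: nested_rep_def is_rep_def in_listset)
  have bs: "block_sum ns \<tau>s \<in> Sym (sum_list ns)" using ts by blast
  have ts': "\<tau>s \<in> Young (map length mss)" "\<tau>s \<in> Young (map length zss)"
    unfolding mss_def zss_def c using ts by simp_all
  have l: "map length (map2 move \<tau>s xss) = map length xss" if "length xss = length ns" for xss ::
      "'x list list"
    using that len by (auto intro: nth_equalityI)
  have 1: "chunks ns (move (block_sum ns \<tau>s \<circ> \<sigma>) ms) = map2 move \<tau>s mss"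
    using c len bs concat_map2_move[OF ts'(1)] l[of mss]
    by (intro chunks_eqI) (simp_all add: move_comp mss_def del: map_map)
  have 2: "chunks ns (move (block_sum ns \<tau>s \<circ> \<sigma>) zs) = map2 move \<tau>s zss"
    using c len bs concat_map2_move[OF ts'(2)] l[of zss]
    by (intro chunks_eqI) (simp_all add: move_comp zss_def del: map_map)
  have "block_perm (block_sum ns \<tau>s \<circ> \<sigma>) ms \<circ> \<tau>
      = block_perm (block_sum ns \<tau>s) (move \<sigma> ms) \<circ> (block_perm \<sigma> ms \<circ> \<tau>)"
    using len bs by (simp add: block_perm_comp comp_assoc)
  also have "block_perm (block_sum ns \<tau>s) (move \<sigma> ms) = block_sum (map sum_list mss) (map2
      block_perm \<tau>s mss)"
    using block_perm_block_sum_nested[OF ts'(1)] c by (simp add: mss_def)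
  finally have 3: "block_perm (block_sum ns \<tau>s \<circ> \<sigma>) ms \<circ> \<tau>
      = block_sum (map sum_list mss) (map2 block_perm \<tau>s mss) \<circ> (block_perm \<sigma> ms \<circ> \<tau>)" .
  have lm: "map length mss = ns" using c by (simp add: mss_def)
  show ?thesis
    unfolding reassociated_def 1 2 3 mss_def[symmetric] zss_def[symmetric]
    by (rule graft_act_middle[OF Y nested_rep_graftable[OF r], folded mss_def zss_def, of \<tau>s,
        unfolded lm, OF ts])
qed

text \<open>Cutting into chunks commutes with acting on the innermost operations, and by
\<open>block_perm_block_sum\<close> the block sum may be formed after the block permutation of \<open>\<sigma>\<close>; what
remains is \<open>graft_act_inner\<close>.\<close>

lemma reassociated_act_inner:
  assumes Y: "s_collection Y" "s_collection Z" and r: "nested_rep X Y Z x ns ys \<sigma> ms zs \<tau>"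
    and ts: "\<tau>s \<in> Young ms"
  shows "reassociated X Y Z x ns ys \<sigma> ms (act_list Z ms zs \<tau>s) \<tau>
    = reassociated X Y Z x ns ys \<sigma> ms zs (block_sum ms \<tau>s \<circ> \<tau>)"
proof -
  note c = nested_rep_chunks[OF r]
  define mss zss where "mss = chunks ns (move \<sigma> ms)" and "zss = chunks ns (move \<sigma> zs)"
  have len: "length ms = sum_list ns" "length zs = sum_list ns" "\<sigma> \<in> Sym (sum_list ns)" "length \<tau>s
      = sum_list ns"
    using r ts by (auto simp: nested_rep_def is_rep_def in_listset)
  define \<tau>ss where "\<tau>ss = chunks ns (move \<sigma> \<tau>s)"
  have ct: "concat \<tau>ss = move \<sigma> \<tau>s" "map length \<tau>ss = ns"
    using concat_chunks[of "move \<sigma> \<tau>s" ns] len by (simp_all add: \<tau>ss_def)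
  have mts: "move \<sigma> \<tau>s \<in> Young (move \<sigma> ms)" using ts len by (simp add: inputs_move)
  from chunks_listset[OF this, of ns] len
  have tss: "\<tau>ss \<in> listset (map Young mss)" by (simp add: \<tau>ss_def mss_def chunks_map comp_def)
  define dss where "dss = map (\<lambda>i. act_list Z (mss ! i) (zss ! i) (\<tau>ss ! i)) [0..<length ns]"
  have lm: "length (mss ! i) = ns ! i" "length (zss ! i) = ns ! i" "length (\<tau>ss ! i) = ns ! i" if
      "i < length ns" for i
    using that c(2,4) ct(2) unfolding mss_def[symmetric] zss_def[symmetric] by (metis length_map
        nth_map)+
  have ds: "chunks ns (move \<sigma> (act_list Z ms zs \<tau>s)) = dss"
  proof (rule chunks_eqI)
    show ml: "map length dss = ns" using lm by (intro nth_equalityI) (simp_all add: dss_def)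
    show "concat dss = move \<sigma> (act_list Z ms zs \<tau>s)"
    proof (rule nth_equalityI)
      show "length (concat dss) = length (move \<sigma> (act_list Z ms zs \<tau>s))"
        using len by (simp add: length_concat ml)
      fix p assume "p < length (concat dss)"
      then have "p < sum_list ns" by (simp add: length_concat ml)
      then obtain i j where ij: "i < length ns" "j < ns ! i" "p = position ns i j" by (rule
          position_exhaust)
      have nc: "concat xss ! p = xss ! i ! j" if "map length xss = ns" for xss :: "'x list list"
        using concat_nth[of i xss j] that ij by (metis length_map nth_map)
      have nth: "concat dss ! p = dss ! i ! j" "move \<sigma> ms ! p = mss ! i ! j" "move \<sigma> zs ! p = zss
          ! i ! j" "move \<sigma> \<tau>s ! p = \<tau>ss ! i ! j"
        using nc[OF ml] nc[OF c(2)] nc[OF c(4)] nc[OF ct(2)] unfolding c ct(1) mss_def zss_def by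
            simp_all
      have "move \<sigma> (act_list Z ms zs \<tau>s) ! p = act Z (move \<sigma> ms ! p) (move \<sigma> zs ! p) (move \<sigma> \<tau>s ! p)"
        using len \<open>p < sum_list ns\<close> by (simp add: move_act_list)
      also have "\<dots> = act Z (mss ! i ! j) (zss ! i ! j) (\<tau>ss ! i ! j)" by (simp only: nth)
      also have "\<dots> = dss ! i ! j" using ij lm by (simp add: dss_def)
      finally show "concat dss ! p = move \<sigma> (act_list Z ms zs \<tau>s) ! p" using nth by simp
    qed
  qed
  have "reassociated X Y Z x ns ys \<sigma> ms (act_list Z ms zs \<tau>s) \<tau> = graft X Y Z x ys mss dss
      (block_perm \<sigma> ms \<circ> \<tau>)"
    by (simp add: reassociated_def ds mss_def)
  also have "\<dots> = graft X Y Z x ys mss zss (block_sum (concat mss) (concat \<tau>ss) \<circ> (block_perm \<sigma> ms \<circ> \<tau>))"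
    using tss unfolding mss_def zss_def
    by (intro graft_act_inner[OF Y nested_rep_graftable[OF r]])
      (simp_all add: in_listset[of _ "map f xs" for f xs] dss_def mss_def zss_def)
  also have "block_sum (concat mss) (concat \<tau>ss) \<circ> (block_perm \<sigma> ms \<circ> \<tau>) = block_perm \<sigma> ms \<circ>
      (block_sum ms \<tau>s \<circ> \<tau>)"
    using block_perm_block_sum[of \<sigma> ms \<tau>s] ts len c ct by (simp add: mss_def comp_assoc[symmetric])
  finally show ?thesis unfolding reassociated_def mss_def zss_def .
qed

text \<open>The first move for the outer of the two nested composites. No regrouping takes place here, since \<open>\<pi>\<close>
is absorbed by the representative of the inner composite, as \<open>[x; ys \<cdot> \<sigma>] \<cdot> \<pi> = [x; ys \<cdot> (\<sigma> \<circ> \<pi>)]\<close>.\<close>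

lemma reassociated_act_outer:
  assumes r: "nested_rep X Y Z x ns ys \<sigma> ms zs \<tau>" and pi: "\<pi> \<in> Sym (sum_list ns)"
  shows "reassociated X Y Z x ns ys (\<sigma> \<circ> \<pi>) ms zs \<tau>
    = reassociated X Y Z x ns ys \<sigma> (move \<pi> ms) (move \<pi> zs) (block_perm \<pi> ms \<circ> \<tau>)"
  using r pi
  by (simp add: reassociated_def nested_rep_def is_rep_def in_listset move_comp block_perm_comp
      comp_assoc)

lemma nested_repI:
  "is_rep X Y x ns ys \<sigma> \<Longrightarrow> is_rep (X \<odot> Y) Z w ms zs \<tau> \<Longrightarrow> length ms = sum_list ns \<Longrightarrow> nested_rep X Y Z
      x ns ys \<sigma> ms zs \<tau>"
  by (simp add: nested_rep_def is_rep_def)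

lemma assoc_inner:
  assumes X: "s_collection X" "s_collection Y" "s_collection Z" and r: "nested_rep X Y Z x ns ys \<sigma>
      ms zs \<tau>"
  shows "on_reps (\<lambda>x ns ys \<sigma>. reassociated X Y Z x ns ys \<sigma> ms zs \<tau>) (cmp_class X Y x ns ys \<sigma>)
    = reassociated X Y Z x ns ys \<sigma> ms zs \<tau>"
proof -
  have rep: "is_rep X Y x ns ys \<sigma>" using r by (simp add: nested_rep_def)
  have n: "nested_rep X Y Z x' ns' ys' \<sigma>' ms zs \<tau>" if "is_rep X Y x' ns' ys' \<sigma>'" "sum_list ns' =
      sum_list ns" for x' ns' ys' \<sigma>'
    using r that by (simp add: nested_rep_def)
  show ?thesis
  proof (rule on_reps_cmp_class[OF X(1,2) rep], goal_cases)
    case (1 x ns' ys \<sigma> \<pi>)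
    then show ?case using reassociated_move[OF X n[OF 1(1,3)], of \<pi>] by simp
  next
    case (2 x ns' ys \<sigma> \<tau>s)
    then show ?case using reassociated_act_middle[OF X(2,3) n[OF 2(1,3)]] by simp
  qed
qed

text \<open>The inner evaluation is invariant under the two moves on \<open>[x; ys \<cdot> \<sigma>]\<close>. In the outer
one, an operation \<open>w\<close> of \<open>X \<odot> Y\<close> is first written as such a class, so that all that is left are the
two moves on the outer representative.\<close>

lemma assoc_class:
  assumes X: "s_collection X" "s_collection Y" "s_collection Z" and r: "nested_rep X Y Z x ns ys \<sigma>
      ms zs \<tau>"
  shows "assoc X Y Z n (cmp_class (X \<odot> Y) Z (cmp_class X Y x ns ys \<sigma>) ms zs \<tau>)
    = reassociated X Y Z x ns ys \<sigma> ms zs \<tau>"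
proof -
  let ?h = "\<lambda>w ms zs \<tau>. on_reps (\<lambda>x ns ys \<sigma>. reassociated X Y Z x ns ys \<sigma> ms zs \<tau>) w"
  have rep: "is_rep (X \<odot> Y) Z (cmp_class X Y x ns ys \<sigma>) ms zs \<tau>"
    using r cmp_class_ops[of X Y x ns ys \<sigma>] by (simp add: nested_rep_def is_rep_def)
  have "assoc X Y Z n = on_reps ?h"
    by (simp add: assoc_def reassociated_def graft_def grafts_def Let_def)
  moreover have "on_reps ?h (cmp_class (X \<odot> Y) Z (cmp_class X Y x ns ys \<sigma>) ms zs \<tau>)
     = ?h (cmp_class X Y x ns ys \<sigma>) ms zs \<tau>"
  proof (rule on_reps_cmp_class[OF s_collection_comp[OF X(1,2)] X(3) rep], goal_cases)
    case (1 w ms' zs \<tau> \<pi>)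
    then have "w \<in> ops (X \<odot> Y) (length ms')" by (simp add: is_rep_def)
    then obtain x ns ys \<sigma> where w: "is_rep X Y x ns ys \<sigma>" "sum_list ns = length ms'" "w =
        cmp_class X Y x ns ys \<sigma>"
      by (rule comp_ops_exhaust)
    have pi: "\<pi> \<in> Sym (sum_list ns)" using 1 w by simp
    have n: "nested_rep X Y Z x ns ys \<sigma> ms' zs \<tau>" by (rule nested_repI[OF w(1) 1(1) w(2)[symmetric]])
    have n1: "nested_rep X Y Z x ns ys (\<sigma> \<circ> \<pi>) ms' zs \<tau>"
      by (rule nested_repI[OF is_rep_comp(1)[OF w(1) pi] 1(1) w(2)[symmetric]])
    have n2: "nested_rep X Y Z x ns ys \<sigma> (move \<pi> ms') (move \<pi> zs) (block_perm \<pi> ms' \<circ> \<tau>)"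
      using pi w by (intro nested_repI[OF w(1) is_rep_move[OF 1(1)]]) simp_all
    have "act (X \<odot> Y) (length ms) w \<pi> = cmp_class X Y x ns ys (\<sigma> \<circ> \<pi>)"
      unfolding w(3) by (rule comp_act[OF X(1,2) w(1) pi])
    then show ?case
      using assoc_inner[OF X n1] assoc_inner[OF X n2] reassociated_act_outer[OF n pi] by (simp add: w(3))
  next
    case (2 w ms' zs \<tau> \<tau>s)
    then have "w \<in> ops (X \<odot> Y) (length ms')" by (simp add: is_rep_def)
    then obtain x ns ys \<sigma> where w: "is_rep X Y x ns ys \<sigma>" "sum_list ns = length ms'" "w =
        cmp_class X Y x ns ys \<sigma>"
      by (rule comp_ops_exhaust)
    have n: "nested_rep X Y Z x ns ys \<sigma> ms' zs \<tau>" by (rule nested_repI[OF w(1) 2(1) w(2)[symmetric]])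
    have n1: "nested_rep X Y Z x ns ys \<sigma> ms' (act_list Z ms' zs \<tau>s) \<tau>"
      using n 2 act_list_closed[OF X(3)] by (simp add: nested_rep_def)
    have n2: "nested_rep X Y Z x ns ys \<sigma> ms' zs (block_sum ms' \<tau>s \<circ> \<tau>)"
      using n 2(3) Sym_comp[OF block_sum_Sym[OF 2(4)], of \<tau>] by (simp add: nested_rep_def)
    show ?case
      using assoc_inner[OF X n1] assoc_inner[OF X n2] reassociated_act_inner[OF X(2,3) n 2(4)] by
          (simp add: w(3))
  qed
  ultimately show ?thesis using assoc_inner[OF X r] by simp
qed

section \<open>Associativity of the structure map\<close>

text \<open>A choice from the regrouped sets comes from a choice before regrouping, namely its
concatenation, as both are cut into chunks of the same sizes. This is where the two sides of the
associativity axiom meet.\<close>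

lemma chunks_image_listset:
  assumes "length Cs = sum_list ns" "\<sigma> \<in> Sym (sum_list ns)"
  shows "(\<lambda>cs. chunks ns (move \<sigma> cs)) ` listset Cs = listset (map listset (chunks ns (move \<sigma> Cs)))"
proof (intro equalityI subsetI)
  fix css assume "css \<in> (\<lambda>cs. chunks ns (move \<sigma> cs)) ` listset Cs"
  then obtain cs where cs: "cs \<in> listset Cs" "css = chunks ns (move \<sigma> cs)" by blast
  have "move \<sigma> cs \<in> listset (move \<sigma> Cs)" using cs assms by (simp add: listset_move)
  then show "css \<in> listset (map listset (chunks ns (move \<sigma> Cs)))"
    using chunks_listset[of "move \<sigma> cs" "move \<sigma> Cs" ns] assms(1) cs(2) by simp
next
  let ?Css = "chunks ns (move \<sigma> Cs)"
  have C: "concat ?Css = move \<sigma> Cs" "map length ?Css = ns"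
    using concat_chunks[of "move \<sigma> Cs" ns] assms by simp_all
  fix css assume css: "css \<in> listset (map listset ?Css)"
  then have len: "map length css = map length ?Css" by (auto simp: in_listset intro: nth_equalityI)
  then have "concat css \<in> listset (move \<sigma> Cs)" using css listset_concat[OF len] C by simp
  then obtain cs where cs: "cs \<in> listset Cs" "concat css = move \<sigma> cs" using assms by (auto simp:
      listset_move)
  have "chunks ns (move \<sigma> cs) = css" using cs(2) len C by (intro chunks_eqI) simp_all
  then show "css \<in> (\<lambda>cs. chunks ns (move \<sigma> cs)) ` listset Cs" using cs(1) by blast
qed

text \<open>A choice from the sets \<open>{[b; cs] | b \<in> B\<^sub>i, cs \<in> Cs\<^sub>i}\<close>, one for each \<open>i\<close>, is a choice of all
\<open>b\<close> and all \<open>cs\<close>, since these may be selected independently for every \<open>i\<close>.\<close>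

lemma listset_grafts:
  assumes Y: "s_collection Y" "s_collection Z"
    and g: "graftable PX (pw e Y) (pw e Z) A Bs mss Css \<rho>"
  shows "listset (map2 (pow_mult Y Z) (map sum_list mss) (grafts (pw e Y) (pw e Z) Bs mss Css))
    = {grafts Y Z bs mss css | bs css. bs \<in> listset Bs \<and> css \<in> listset (map listset Css)}" (is
        "listset ?L = ?R")
proof -
  have len: "length Bs = length mss" "length Css = length mss" using g by (auto simp:
      graftable_def in_listset)
  have L: "length ?L = length mss" by simp
  have nth: "?L ! i = {cmp_class Y Z b (mss ! i) cs id | b cs. b \<in> Bs ! i \<and> cs \<in> listset (Css !
      i)}" if "i < length mss" for i
    using that pow_mult_class[OF Y graftable_nth[OF g that]] by simp
  show ?thesis
  proof (intro equalityI subsetI)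
    fix ds assume ds: "ds \<in> listset ?L"
    have "\<forall>i<length mss. \<exists>b cs. b \<in> Bs ! i \<and> cs \<in> listset (Css ! i) \<and> ds ! i = cmp_class Y Z b
        (mss ! i) cs id"
    proof (intro allI impI)
      fix i assume i: "i < length mss"
      then have "ds ! i \<in> ?L ! i" using ds unfolding in_listset L by blast
      then show "\<exists>b cs. b \<in> Bs ! i \<and> cs \<in> listset (Css ! i) \<and> ds ! i = cmp_class Y Z b (mss ! i) cs id"
        unfolding nth[OF i] by blast
    qed
    then obtain b c where bc: "\<And>i. i < length mss \<Longrightarrow> b i \<in> Bs ! i \<and> c i \<in> listset (Css ! i)
        \<and> ds ! i = cmp_class Y Z (b i) (mss ! i) (c i) id" by metis
    have "ds = grafts Y Z (map b [0..<length mss]) mss (map c [0..<length mss])"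
    proof (rule nth_equalityI)
      show "length ds = length (grafts Y Z (map b [0..<length mss]) mss (map c [0..<length mss]))"
        using ds unfolding in_listset L by simp
    qed (use ds bc in \<open>simp add: in_listset\<close>)
    moreover have "map b [0..<length mss] \<in> listset Bs" "map c [0..<length mss] \<in> listset (map
        listset Css)"
      using bc len by (auto simp: in_listset[of "map f xs" for f xs])
    ultimately show "ds \<in> ?R" by blast
  next
    fix ds assume "ds \<in> ?R"
    then obtain bs css where *: "ds = grafts Y Z bs mss css" "bs \<in> listset Bs" "css \<in> listset (map
        listset Css)" by blast
    have "bs ! i \<in> Bs ! i \<and> css ! i \<in> listset (Css ! i)" if "i < length mss" for i
      using that *(2,3) len unfolding in_listset[of bs] in_listset[of css] by simp
    then have "grafts Y Z bs mss css ! i \<in> ?L ! i" if "i < length mss" for i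
      unfolding nth[OF that] grafts_nth[OF that] using that by blast
    then show "ds \<in> listset ?L" unfolding *(1) in_listset[of "grafts _ _ _ _ _"] L by simp
  qed
qed

text \<open>Both sides are the set of all \<open>graft X Y Z a bs mss css \<rho>\<close> with \<open>a\<close>, \<open>bs\<close> and \<open>css\<close> chosen in the
given subsets. The left-hand side chooses before regrouping, the right-hand side afterwards.\<close>

lemma pow_mult_assoc:
  assumes X: "s_collection X" and Y: "s_collection Y" and Z: "s_collection Z"
  shows "mor_eq ((pw e X \<odot> pw e Y) \<odot> pw e Z)
        (img (assoc X Y Z) \<cdot> pow_mult (X \<odot> Y) Z
          \<cdot> prod_mor (pw e (X \<odot> Y)) (pw e Z) (pow_mult X Y) mor_id)
        (pow_mult X (Y \<odot> Z) \<cdot> prod_mor (pw e X) (pw e (Y \<odot> Z)) mor_id (pow_mult Y Z)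
          \<cdot> assoc (pw e X) (pw e Y) (pw e Z))"
  unfolding mor_eq_def
proof (intro allI ballI)
  note XY = s_collection_comp[OF X Y] and YZ = s_collection_comp[OF Y Z]
  note P = s_collection_pw[of _ e]
  note PX = P[OF X] and PY = P[OF Y] and PZ = P[OF Z]
  fix n z assume "z \<in> ops ((pw e X \<odot> pw e Y) \<odot> pw e Z) n"
  then obtain w ms Cs \<tau> where z: "is_rep (pw e X \<odot> pw e Y) (pw e Z) w ms Cs \<tau>" "sum_list ms = n"
    "z = cmp_class (pw e X \<odot> pw e Y) (pw e Z) w ms Cs \<tau>" by (rule comp_ops_exhaust)
  then have "w \<in> ops (pw e X \<odot> pw e Y) (length ms)" by (simp add: is_rep_def)
  then obtain A ns Bs \<sigma> where w: "is_rep (pw e X) (pw e Y) A ns Bs \<sigma>" "sum_list ns = length ms"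
    "w = cmp_class (pw e X) (pw e Y) A ns Bs \<sigma>" by (rule comp_ops_exhaust)
  have nr: "nested_rep (pw e X) (pw e Y) (pw e Z) A ns Bs \<sigma> ms Cs \<tau>"
    by (rule nested_repI[OF w(1) z(1) w(2)[symmetric]])
  have lenC [simp]: "length Cs = length ms" by (rule length_inputs[OF z(1)])
  define mss Css \<rho> where "mss = chunks ns (move \<sigma> ms)" and "Css = chunks ns (move \<sigma> Cs)"
    and "\<rho> = block_perm \<sigma> ms \<circ> \<tau>"
  have g: "graftable (pw e X) (pw e Y) (pw e Z) A Bs mss Css \<rho>"
    using nested_rep_graftable[OF nr] by (simp add: mss_def Css_def \<rho>_def)

  have rep1: "is_rep (pw e (X \<odot> Y)) (pw e Z) (pow_mult X Y (length ms) w) ms Cs \<tau>"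
    using is_rep_map[OF morphism_pow_mult[OF X Y] morphism_id z(1)] by simp
  have pw1: "pow_mult X Y (length ms) w = {cmp_class X Y a ns bs \<sigma> | a bs. a \<in> A \<and> bs \<in> listset Bs}"
    unfolding w(3) by (rule pow_mult_class[OF X Y w(1)])
  have val: "assoc X Y Z n (cmp_class (X \<odot> Y) Z (cmp_class X Y a ns bs \<sigma>) ms cs \<tau>)
      = graft X Y Z a bs mss (chunks ns (move \<sigma> cs)) \<rho>"
    if "a \<in> A" "bs \<in> listset Bs" "cs \<in> listset Cs" for a bs cs
  proof -
    have "cmp_class X Y a ns bs \<sigma> \<in> pow_mult X Y (length ms) w" using that pw1 by blast
    from nested_repI[OF pw_rep_choose[OF w(1) that(1,2)] pw_rep_choose[OF rep1 this that(3)]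
        w(2)[symmetric]]
    show ?thesis by (simp add: assoc_class[OF X Y Z] reassociated_def mss_def \<rho>_def)
  qed
  have "(img (assoc X Y Z) \<cdot> pow_mult (X \<odot> Y) Z
          \<cdot> prod_mor (pw e (X \<odot> Y)) (pw e Z) (pow_mult X Y) mor_id) n z
     = assoc X Y Z n ` {cmp_class (X \<odot> Y) Z v ms cs \<tau> | v cs. v \<in> pow_mult X Y (length ms) w \<and> cs
         \<in> listset Cs}"
    unfolding mor_comp_def img_def z(3)
      prod_mor_class[OF s_collection_comp[OF PX PY] PZ P[OF XY] PZ morphism_pow_mult[OF X Y]
          morphism_id z(1)]
    using pow_mult_class[OF XY Z rep1] by simp
  also have "\<dots> = {graft X Y Z a bs mss (chunks ns (move \<sigma> cs)) \<rho> | a bs cs. a \<in> A \<and> bs \<in> listset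
      Bs \<and> cs \<in> listset Cs}"
    (is "?l = ?r")
  proof (intro equalityI subsetI)
    fix q assume "q \<in> ?l"
    then obtain a bs cs where "q = assoc X Y Z n (cmp_class (X \<odot> Y) Z (cmp_class X Y a ns bs \<sigma>) ms cs \<tau>)"
      "a \<in> A" "bs \<in> listset Bs" "cs \<in> listset Cs" unfolding pw1 by blast
    then show "q \<in> ?r" using val by blast
  next
    fix q assume "q \<in> ?r"
    then obtain a bs cs where "q = graft X Y Z a bs mss (chunks ns (move \<sigma> cs)) \<rho>"
      "a \<in> A" "bs \<in> listset Bs" "cs \<in> listset Cs" by blast
    then show "q \<in> ?l" using val[symmetric] unfolding pw1 by blast
  qed
  also have "\<dots> = {graft X Y Z a bs mss css \<rho> | a bs css. a \<in> A \<and> bs \<in> listset Bs \<and> css \<in> listset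
      (map listset Css)}"
  proof -
    have "\<sigma> \<in> Sym (sum_list ns)" using w(1) by (simp add: is_rep_def)
    then have "listset (map listset Css) = (\<lambda>cs. chunks ns (move \<sigma> cs)) ` listset Cs"
      unfolding Css_def by (rule chunks_image_listset[symmetric, rotated]) (simp add: w(2))
    then show ?thesis by auto
  qed
  finally have lhs: "(img (assoc X Y Z) \<cdot> pow_mult (X \<odot> Y) Z
          \<cdot> prod_mor (pw e (X \<odot> Y)) (pw e Z) (pow_mult X Y) mor_id) n z
     = {graft X Y Z a bs mss css \<rho> | a bs css. a \<in> A \<and> bs \<in> listset Bs \<and> css \<in> listset (map
         listset Css)}" .

  have "assoc (pw e X) (pw e Y) (pw e Z) n z = graft (pw e X) (pw e Y) (pw e Z) A Bs mss Css \<rho>"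
    unfolding z(3) w(3) assoc_class[OF PX PY PZ nr] by (simp add: reassociated_def mss_def Css_def \<rho>_def)
  moreover have "prod_mor (pw e X) (pw e (Y \<odot> Z)) mor_id (pow_mult Y Z) n (graft (pw e X) (pw e Y)
      (pw e Z) A Bs mss Css \<rho>)
     = cmp_class (pw e X) (pw e (Y \<odot> Z)) A (map sum_list mss)
         (map2 (pow_mult Y Z) (map sum_list mss) (grafts (pw e Y) (pw e Z) Bs mss Css)) \<rho>"
    unfolding graft_def
      prod_mor_class[OF PX s_collection_comp[OF PY PZ] PX P[OF YZ] morphism_id
          morphism_pow_mult[OF Y Z] graftable_rep[OF g]]
    by (simp add: mor_id_def)
  moreover have "is_rep (pw e X) (pw e (Y \<odot> Z)) A (map sum_list mss)
         (map2 (pow_mult Y Z) (map sum_list mss) (grafts (pw e Y) (pw e Z) Bs mss Css)) \<rho>"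
    using is_rep_map[OF morphism_id morphism_pow_mult[OF Y Z] graftable_rep[OF g]] by (simp add:
        mor_id_def)
  from pow_mult_class[OF X YZ this, of n]
  have "pow_mult X (Y \<odot> Z) n (cmp_class (pw e X) (pw e (Y \<odot> Z)) A (map sum_list mss)
         (map2 (pow_mult Y Z) (map sum_list mss) (grafts (pw e Y) (pw e Z) Bs mss Css)) \<rho>)
     = {graft X Y Z a bs mss css \<rho> | a bs css. a \<in> A \<and> bs \<in> listset Bs \<and> css \<in> listset (map
         listset Css)}"
    unfolding listset_grafts[OF Y Z g] graft_def by blast
  ultimately show "(img (assoc X Y Z) \<cdot> pow_mult (X \<odot> Y) Z
          \<cdot> prod_mor (pw e (X \<odot> Y)) (pw e Z) (pow_mult X Y) mor_id) n z
     = (pow_mult X (Y \<odot> Z) \<cdot> prod_mor (pw e X) (pw e (Y \<odot> Z)) mor_id (pow_mult Y Z)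
          \<cdot> assoc (pw e X) (pw e Y) (pw e Z)) n z"
    unfolding lhs by (simp add: mor_comp_def)
qed

theorem proposition2p3:
  fixes X :: "'a scoll" and X' :: "'a1 scoll" and X'' :: "'a2 scoll"
    and Y :: "'b scoll" and Y' :: "'b1 scoll" and Z :: "'c scoll"
    and f :: "('a, 'a1) mor" and f' :: "('a1, 'a2) mor" and g :: "('b, 'b1) mor"
  assumes "s_collection X" "s_collection X'" "s_collection X''"
    and "s_collection Y" "s_collection Y'" "s_collection Z"
    and "morphism X X' f" "morphism X' X'' f'" "morphism Y Y' g"
  shows
    "( \<comment> \<open>the endofunctor \<open>\<P>\<close>\<close>
      s_collection (\<P> X) \<and>
      morphism (\<P> X) (\<P> X') (img f) \<and>
      mor_eq (\<P> X) (img mor_id) mor_id \<and>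
      mor_eq (\<P> X) (img (f' \<cdot> f)) (img f' \<cdot> img f) \<and>
      \<comment> \<open>its structure maps and their naturality\<close>
      morphism (\<P> X \<odot> \<P> Y) (\<P> (X \<odot> Y)) (pow_mult X Y) \<and>
      morphism \<I> (\<P> \<I>) pow_unit \<and>
      mor_eq (\<P> X \<odot> \<P> Y)
        (img (prod_mor X' Y' f g) \<cdot> pow_mult X Y)
        (pow_mult X' Y' \<cdot> prod_mor (\<P> X') (\<P> Y') (img f) (img g)) \<and>
      \<comment> \<open>associativity and unit coherence\<close>
      mor_eq ((\<P> X \<odot> \<P> Y) \<odot> \<P> Z)
        (img (assoc X Y Z) \<cdot> pow_mult (X \<odot> Y) Z
          \<cdot> prod_mor (\<P> (X \<odot> Y)) (\<P> Z) (pow_mult X Y) mor_id)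
        (pow_mult X (Y \<odot> Z) \<cdot> prod_mor (\<P> X) (\<P> (Y \<odot> Z)) mor_id (pow_mult Y Z)
          \<cdot> assoc (\<P> X) (\<P> Y) (\<P> Z)) \<and>
      mor_eq (\<I> \<odot> \<P> X)
        (img (lunit X) \<cdot> pow_mult \<I> X \<cdot> prod_mor (\<P> \<I>) (\<P> X) pow_unit mor_id)
        (lunit (\<P> X)) \<and>
      mor_eq (\<P> X \<odot> \<I>)
        (img (runit X) \<cdot> pow_mult X \<I> \<cdot> prod_mor (\<P> X) (\<P> \<I>) mor_id pow_unit)
        (runit (\<P> X)))
     \<and>
     ( \<comment> \<open>the same for \<open>\<P>\<^sub>+\<close>\<close>
      s_collection (\<P>\<^sub>+ X) \<and>
      morphism (\<P>\<^sub>+ X) (\<P>\<^sub>+ X') (img f) \<and>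
      mor_eq (\<P>\<^sub>+ X) (img mor_id) mor_id \<and>
      mor_eq (\<P>\<^sub>+ X) (img (f' \<cdot> f)) (img f' \<cdot> img f) \<and>
      morphism (\<P>\<^sub>+ X \<odot> \<P>\<^sub>+ Y) (\<P>\<^sub>+ (X \<odot> Y)) (pow_mult X Y) \<and>
      morphism \<I> (\<P>\<^sub>+ \<I>) pow_unit \<and>
      mor_eq (\<P>\<^sub>+ X \<odot> \<P>\<^sub>+ Y)
        (img (prod_mor X' Y' f g) \<cdot> pow_mult X Y)
        (pow_mult X' Y' \<cdot> prod_mor (\<P>\<^sub>+ X') (\<P>\<^sub>+ Y') (img f) (img g)) \<and>
      mor_eq ((\<P>\<^sub>+ X \<odot> \<P>\<^sub>+ Y) \<odot> \<P>\<^sub>+ Z)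
        (img (assoc X Y Z) \<cdot> pow_mult (X \<odot> Y) Z
          \<cdot> prod_mor (\<P>\<^sub>+ (X \<odot> Y)) (\<P>\<^sub>+ Z) (pow_mult X Y) mor_id)
        (pow_mult X (Y \<odot> Z) \<cdot> prod_mor (\<P>\<^sub>+ X) (\<P>\<^sub>+ (Y \<odot> Z)) mor_id (pow_mult Y Z)
          \<cdot> assoc (\<P>\<^sub>+ X) (\<P>\<^sub>+ Y) (\<P>\<^sub>+ Z)) \<and>
      mor_eq (\<I> \<odot> \<P>\<^sub>+ X)
        (img (lunit X) \<cdot> pow_mult \<I> X \<cdot> prod_mor (\<P>\<^sub>+ \<I>) (\<P>\<^sub>+ X) pow_unit mor_id)
        (lunit (\<P>\<^sub>+ X)) \<and>
      mor_eq (\<P>\<^sub>+ X \<odot> \<I>)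
        (img (runit X) \<cdot> pow_mult X \<I> \<cdot> prod_mor (\<P>\<^sub>+ X) (\<P>\<^sub>+ \<I>) mor_id pow_unit)
        (runit (\<P>\<^sub>+ X)))"
  unfolding pow_coll_pw npow_coll_pw
  by (intro conjI; rule s_collection_pw morphism_img img_id img_comp morphism_pow_mult
      morphism_pow_unit pow_mult_natural pow_mult_assoc pow_lunit pow_runit; fact)

end
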